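(* (i) Let $S\equiv\pm\{1, 8, 10, 11, 12, 13, 14, 15, 17, 19, 21, 23\}\pmod{60}$ and $T\equiv\pm\{1, 7, 9, 10, 11, 12, 13, 15, 23, 26, 28, 29\}\pmod{60}$. Then $p(S,n)=p(T,n-1)$ for all $n\geq 1$. (ii) Let $S\equiv\pm\{2, 3, 7, 10, 11, 15, 16, 17, 19, 23, 24, 29\}\pmod{60}$ and $T\equiv\pm\{1, 4, 7, 10, 13, 15, 17, 19, 22, 24, 27, 29\}\pmod{60}$. Then $p(S,n)=p(T,n-2)$ for all $n\geq 2$. (iii) Let $S\equiv\pm\{1, 3, 4, 10, 11, 13, 15, 17, 22, 23, 24, 29\}\pmod{60}$ and $T\equiv\pm\{1, 2, 7, 10, 11, 13, 15, 16, 19, 23, 24, 27\}\pmod{60}$. Then $p(S,n)=p(T,n)$ for all integers $n\ge0$ with $n\neq 2$. (iv) Let $S\equiv\pm\{7, 8, 9, 10, 11, 12, 13, 14, 15, 17, 19, 29\}\pmod{60}$ and $T\equiv\pm\{1, 7, 10, 12, 15, 17, 19, 21, 23, 26, 28, 29\}\pmod{60}$. Then $p(S,n)=p(T,n-7)$ for all $n\geq 7$.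
   Context: For a set $S$ of positive integers and an integer $n\ge 0$, $p(S,n)$ denotes the number of partitions of $n$ into parts belonging to $S$ (so $p(S,0)=1$). The notation $S\equiv\pm\{r_1,\dots,r_k\}\pmod M$ means that $S$ is the set of all positive integers $n$ such that $n\equiv r_i$ or $n\equiv -r_i\pmod M$ for some $i$. *)

theory Defs
  imports "HOL-Library.Multiset" "HOL-Number_Theory.Cong"
begin

text \<open>
  A partition of \<open>n\<close> into parts from \<open>S\<close> is a finite multiset of elements of \<open>S\<close> with sum \<open>n\<close>.
  The set below is finite if \<open>0 \<notin> S\<close>, so that \<^const>\<open>card\<close> has its intended meaning;
  the sets given by \<open>pm_residues\<close> consist of positive integers only.
\<close>

definition partition_count :: "nat set \<Rightarrow> nat \<Rightarrow> nat" where
  "partition_count S n = card {P :: nat multiset. set_mset P \<subseteq> S \<and> sum_mset P = n}"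

definition pm_residues :: "int set \<Rightarrow> int \<Rightarrow> nat set" where
  "pm_residues R M = {n. 0 < n \<and> (\<exists>r\<in>R. [int n = r] (mod M) \<or> [int n = - r] (mod M))}"

end

theory Submission
  imports Defs "HOL-Complex_Analysis.Cauchy_Integral_Formula"
begin

text \<open>
  Write \<open>[a]\<close> for \<open>(q\<^sup>a; q\<^sup>6\<^sup>0)\<^sub>\<infinity> (q\<^bsup>60-a\<^esup>; q\<^sup>6\<^sup>0)\<^sub>\<infinity>\<close>, so that the generating function of
  the partitions into parts congruent to \<open>\<plusminus>r\<close> modulo 60, \<open>r \<in> R\<close>, is the inverse of the product
  of the \<open>[r]\<close>. Each part of the theorem then says that the difference of two products of five
  theta functions is a product of seventeen. Parts (i) and (iv) both follow by eliminating mixed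
  terms between the two Weierstrass relations
  \<open>[9] Z = [26,28] [1,23] + q [8,14] [17,19]\<close> and
  \<open>[21] Z = [26,28] [7,29] + q\<^sup>7 [8,14] [11,13]\<close>, where \<open>Z = [15,18,20]\<close>:
  what is left is \<open>[26,28]\<^sup>2 [1,7,23,29] - q\<^sup>8 [8,14]\<^sup>2 [11,13,17,19]\<close>, which
  is a product by a Weierstrass relation of modulus 30 with two negative arguments. Parts (ii) and (iii)
  follow in the same way from the relations obtained by multiplying all residues by 7. The
  Weierstrass relation itself is the Pluecker relation for \<open>2 \<times> 2\<close> determinants, once the Jacobi
  triple product has been used to write \<open>\<theta>(xy) \<theta>(x/y)\<close> as such a determinant.
\<close>

subsection \<open>Infinite q-products\<close>

definition qpoch :: "real \<Rightarrow> real \<Rightarrow> real" where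
  "qpoch z Q = (\<Prod>i. 1 - z * Q ^ i)"

lemma qpoch_convergent_prod:
  fixes Q z :: real
  assumes "\<bar>Q\<bar> < 1"
  shows "convergent_prod (\<lambda>i. 1 - z * Q ^ i)"
proof -
  have "summable (\<lambda>i. norm ((1 - z * Q ^ i) - 1))"
    using assms by (simp add: abs_mult power_abs summable_mult)
  then show ?thesis
    by (intro abs_convergent_prod_imp_convergent_prod summable_imp_abs_convergent_prod)
qed

lemma qpoch_LIMSEQ:
  assumes "\<bar>Q\<bar> < 1"
  shows "(\<lambda>n. \<Prod>i<n. 1 - z * Q ^ i) \<longlonglongrightarrow> qpoch z Q"
  using convergent_prod_LIMSEQ[OF qpoch_convergent_prod[OF assms, of z]]
  unfolding qpoch_def by (simp add: LIMSEQ_lessThan_iff_atMost)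

lemma qpoch_nonzero:
  assumes "\<bar>Q\<bar> < 1" "\<And>i. z * Q ^ i \<noteq> 1"
  shows "qpoch z Q \<noteq> 0"
  using prodinf_nonzero[OF qpoch_convergent_prod[OF assms(1)]] assms(2) 
  unfolding qpoch_def by (metis eq_iff_diff_eq_0)

text \<open>The infinite product is a limit of positive partial products, hence nonnegative, and it
  is not 0 because no factor is.\<close>

lemma qpoch_pos:
  assumes "0 < Q" "Q < 1" "z < 1"
  shows "qpoch z Q > 0"
proof -
  have lt: "z * Q ^ i < 1" for i
  proof (cases "z \<le> 0")
    case True
    then have "z * Q ^ i \<le> 0" using assms by (simp add: mult_nonpos_nonneg)
    then show ?thesis by simp
  next
    case False
    then have "z * Q ^ i \<le> z" using assms by (simp add: mult_le_cancel_left1 power_le_one)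
    then show ?thesis using assms by simp
  qed
  then have "qpoch z Q \<noteq> 0"
    using assms by (intro qpoch_nonzero) (auto simp: less_le)
  moreover have "qpoch z Q \<ge> 0"
    using qpoch_LIMSEQ[of Q z] assms lt
    by (intro tendsto_lowerbound[of "\<lambda>n. \<Prod>i<n. 1 - z * Q ^ i"]) (auto intro!: always_eventually prod_nonneg simp: less_imp_le)
  ultimately show ?thesis by simp
qed

text \<open>Factors with even and with odd index are collected separately; the partial products with
  \<open>2 * n\<close> factors determine the limit.\<close>

lemma qpoch_bisect:
  assumes "\<bar>Q\<bar> < 1"
  shows "qpoch z Q = qpoch z (Q\<^sup>2) * qpoch (z * Q) (Q\<^sup>2)"
proof (rule LIMSEQ_unique)
  have Q2: "\<bar>Q\<^sup>2\<bar> < 1"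
    using assms by (simp add: abs_square_less_1)
  show "(\<lambda>n. \<Prod>i<2 * n. 1 - z * Q ^ i) \<longlonglongrightarrow> qpoch z Q"
    using LIMSEQ_subseq_LIMSEQ[OF qpoch_LIMSEQ[OF assms, of z], of "\<lambda>n. 2 * n"]
    by (simp add: o_def strict_mono_def)
  have "(\<Prod>i<2 * n. 1 - z * Q ^ i) =
      (\<Prod>i<n. 1 - z * (Q\<^sup>2) ^ i) * (\<Prod>i<n. 1 - z * Q * (Q\<^sup>2) ^ i)" for n
    by (induction n) (simp_all flip: power_mult add: mult.assoc)
  then show "(\<lambda>n. \<Prod>i<2 * n. 1 - z * Q ^ i) \<longlonglongrightarrow> qpoch z (Q\<^sup>2) * qpoch (z * Q) (Q\<^sup>2)"
    using tendsto_mult[OF qpoch_LIMSEQ[OF Q2, of z] qpoch_LIMSEQ[OF Q2, of "z * Q"]] by simp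
qed

text \<open>Factor by factor this is the difference of two squares.\<close>

lemma qpoch_mult_minus:
  assumes "\<bar>Q\<bar> < 1"
  shows "qpoch z Q * qpoch (- z) Q = qpoch (z\<^sup>2) (Q\<^sup>2)"
proof -
  have "(1 - z * Q ^ i) * (1 - - z * Q ^ i) = 1 - z\<^sup>2 * (Q\<^sup>2) ^ i" for i
  proof -
    have "(Q\<^sup>2) ^ i = Q ^ i * Q ^ i"
      by (simp add: power2_eq_square power_mult_distrib)
    then show ?thesis
      by (simp add: algebra_simps power2_eq_square)
  qed
  then show ?thesis
    unfolding qpoch_def
    using prodinf_mult[OF qpoch_convergent_prod[OF assms, of z] qpoch_convergent_prod[OF assms, of "-z"]]
    by simp
qed

definition mod_theta :: "real \<Rightarrow> real \<Rightarrow> real" where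
  "mod_theta Q z = qpoch z Q * qpoch (Q / z) Q"

lemma mod_theta_reflect: "z \<noteq> 0 \<Longrightarrow> Q \<noteq> 0 \<Longrightarrow> mod_theta Q (Q / z) = mod_theta Q z"
  by (simp add: mod_theta_def)

text \<open>Together with \<open>mod_theta_mult_minus\<close> this later rewrites theta functions of
  modulus 30, also at negative arguments, through those of modulus 60.\<close>

lemma mod_theta_bisect:
  assumes "\<bar>Q\<bar> < 1" "Q \<noteq> 0" "z \<noteq> 0"
  shows "mod_theta Q z = mod_theta (Q\<^sup>2) z * mod_theta (Q\<^sup>2) (Q / z)"
  using assms by (simp add: mod_theta_def qpoch_bisect[of Q z] qpoch_bisect[of Q "Q / z"] power2_eq_square mult.commute)

lemma mod_theta_mult_minus:
  assumes "\<bar>Q\<bar> < 1"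
  shows "mod_theta Q z * mod_theta Q (- z) = mod_theta (Q\<^sup>2) (z\<^sup>2)"
  using qpoch_mult_minus[OF assms, of z] qpoch_mult_minus[OF assms, of "Q / z"]
  by (simp add: mod_theta_def power_divide mult_ac)

subsection \<open>The Jacobi triple product\<close>

text \<open>The alternating sign of the triple product is left to the argument:
  \<open>theta_term Q (- z)\<close> is the summand that belongs to
  \<open>mod_theta Q z\<close>.\<close>

definition theta_term :: "real \<Rightarrow> real \<Rightarrow> int \<Rightarrow> real" where
  "theta_term Q z n = Q powi (n * (n - 1) div 2) * z powi n"

lemma theta_term_add_1:
  assumes "Q \<noteq> 0" "z \<noteq> 0"
  shows "theta_term Q z (n + 1) = z * Q powi n * theta_term Q z n"
proof -
  have "(n + 1) * (n + 1 - 1) div 2 = n * (n - 1) div 2 + n"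
  proof -
    have "(n + 1) * (n + 1 - 1) = n * (n - 1) + n * 2" by (simp add: algebra_simps)
    then show ?thesis by simp
  qed
  with assms show ?thesis
    by (simp add: theta_term_def power_int_add mult_ac)
qed

lemma theta_term_uminus:
  assumes "Q \<noteq> 0" "z \<noteq> 0"
  shows "theta_term Q z (- n) = theta_term Q (Q / z) n"
proof -
  have "- n * (- n - 1) div 2 = n * (n - 1) div 2 + n"
  proof -
    have "- n * (- n - 1) = n * (n - 1) + n * 2" by (simp add: algebra_simps)
    then show ?thesis by simp
  qed
  with assms show ?thesis
    by (simp add: theta_term_def power_int_add power_int_minus power_int_divide_distrib divide_simps)
qed

lemma summable_theta_term_nat:
  assumes "0 < Q" "Q < 1" "z \<noteq> 0"
  shows "summable (\<lambda>n. norm (theta_term Q z (int n)))"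
proof -
  have "(\<lambda>n. \<bar>z\<bar> * Q ^ n) \<longlonglongrightarrow> \<bar>z\<bar> * 0"
    using assms by (intro tendsto_intros LIMSEQ_power_zero) auto
  then have "eventually (\<lambda>n. \<bar>z\<bar> * Q ^ n < 1 / 2) sequentially"
    by (rule order_tendstoD) auto
  then obtain N where N: "\<And>n. n \<ge> N \<Longrightarrow> \<bar>z\<bar> * Q ^ n < 1 / 2"
    unfolding eventually_sequentially by blast
  show ?thesis
  proof (rule summable_ratio_test[of "1/2" N])
    fix n assume "n \<ge> N"
    have "norm (theta_term Q z (int (Suc n))) = \<bar>z\<bar> * Q ^ n * norm (theta_term Q z (int n))"
      using theta_term_add_1[of Q z "int n"] assms by (simp add: abs_mult add.commute)
    also have "\<dots> \<le> 1 / 2 * norm (theta_term Q z (int n))"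
      using N[OF \<open>n \<ge> N\<close>] by (intro mult_right_mono) auto
    finally show "norm (norm (theta_term Q z (int (Suc n)))) \<le> 1 / 2 * norm (norm (theta_term Q z (int n)))"
      by simp
  qed simp
qed

text \<open>Cutting at 0 makes the ratio test and Tannery's theorem for ordinary series available
  for sums over all integers.\<close>

lemma has_sum_int_split:
  fixes f :: "int \<Rightarrow> real"
  assumes "summable (\<lambda>n. norm (f (int n)))" "summable (\<lambda>n. norm (f (- 1 - int n)))"
  shows "(f has_sum ((\<Sum>n. f (int n)) + (\<Sum>n. f (- 1 - int n)))) UNIV"
proof -
  have "((f \<circ> int) has_sum (\<Sum>n. f (int n))) UNIV"
    unfolding o_def using assms(1) by (intro norm_summable_imp_has_sum summable_sums[OF summable_norm_cancel])
  then have 1: "(f has_sum (\<Sum>n. f (int n))) (range int)"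
    by (simp add: has_sum_reindex)
  have "((f \<circ> (\<lambda>n. - 1 - int n)) has_sum (\<Sum>n. f (- 1 - int n))) UNIV"
    unfolding o_def using assms(2) by (intro norm_summable_imp_has_sum summable_sums[OF summable_norm_cancel])
  then have 2: "(f has_sum (\<Sum>n. f (- 1 - int n))) (range (\<lambda>n. - 1 - int n))"
    by (subst has_sum_reindex) (auto simp: inj_on_def)
  have disj: "range int \<inter> range (\<lambda>n. - 1 - int n) = {}"
    by auto
  have "x \<in> range int \<union> range (\<lambda>n. - 1 - int n)" for x
  proof (cases "x \<ge> 0")
    case True then show ?thesis by (auto intro: range_eqI[of _ _ "nat x"])
  next
    case False then show ?thesis by (auto intro: range_eqI[of _ _ "nat (- 1 - x)"])
  qed
  then have "range int \<union> range (\<lambda>n. - 1 - int n) = UNIV" by blast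
  with has_sum_Un_disjoint[OF 1 2 disj] show ?thesis by simp
qed

lemma summable_theta_term_neg:
  assumes "0 < Q" "Q < 1" "z \<noteq> 0"
  shows "summable (\<lambda>n. norm (theta_term Q z (- 1 - int n)))"
proof -
  have "theta_term Q z (- 1 - int n) = theta_term Q (Q / z) (int (Suc n))" for n
    using theta_term_uminus[of Q z "int (Suc n)"] assms by simp
  moreover have "summable (\<lambda>n. norm (theta_term Q (Q / z) (int (Suc n))))"
    using summable_theta_term_nat[of Q "Q / z"] assms by (subst summable_Suc_iff) auto
  ultimately show ?thesis by presburger
qed

lemma theta_term_summable_on:
  assumes "0 < Q" "Q < 1" "z \<noteq> 0"
  shows "theta_term Q z summable_on UNIV"
  using has_sum_int_split[OF summable_theta_term_nat[OF assms] summable_theta_term_neg[OF assms]]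
  by (rule has_sum_imp_summable)

text \<open>Dominated convergence for bilateral sums: Tannery's theorem is applied to the
  nonnegative and to the negative indices.\<close>

lemma tannery_int:
  fixes a :: "int \<Rightarrow> nat \<Rightarrow> real"
  assumes lim: "\<And>k. (\<lambda>n. a k n) \<longlonglongrightarrow> b k"
    and bd: "\<And>k n. \<bar>a k n\<bar> \<le> M k"
    and M: "summable (\<lambda>i. M (int i))" "summable (\<lambda>i. M (- 1 - int i))"
  shows "(\<lambda>n. infsum (\<lambda>k. a k n) UNIV) \<longlonglongrightarrow> infsum b UNIV"
proof -
  have sa: "summable (\<lambda>i. norm (a (int i) n))" "summable (\<lambda>i. norm (a (- 1 - int i) n))" for n
    using M by (auto intro: summable_comparison_test'[where N = 0] simp: bd)
  have "\<bar>b k\<bar> \<le> M k" for k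
    using tendsto_upperbound[OF tendsto_rabs[OF lim[of k]], of "M k"] bd by auto
  then have sb: "summable (\<lambda>i. norm (b (int i)))" "summable (\<lambda>i. norm (b (- 1 - int i)))"
    using M by (auto intro: summable_comparison_test'[where N = 0])
  have "(\<lambda>n. \<Sum>i. a (int i) n) \<longlonglongrightarrow> (\<Sum>i. b (int i))"
    using tannerys_theorem[of "\<lambda>i. a (int i)" "\<lambda>i. b (int i)" sequentially "\<lambda>i. M (int i)"] lim bd M
    by (auto intro: always_eventually)
  moreover have "(\<lambda>n. \<Sum>i. a (- 1 - int i) n) \<longlonglongrightarrow> (\<Sum>i. b (- 1 - int i))"
    using tannerys_theorem[of "\<lambda>i. a (- 1 - int i)" "\<lambda>i. b (- 1 - int i)" sequentially "\<lambda>i. M (- 1 - int i)"] lim bd M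
    by (auto intro: always_eventually)
  ultimately have "(\<lambda>n. (\<Sum>i. a (int i) n) + (\<Sum>i. a (- 1 - int i) n)) \<longlonglongrightarrow> (\<Sum>i. b (int i)) + (\<Sum>i. b (- 1 - int i))"
    by (rule tendsto_add)
  then show ?thesis
    using infsumI[OF has_sum_int_split[OF sa]] infsumI[OF has_sum_int_split[OF sb]] by simp
qed

section \<open>Reciprocal q-factorials and the finite form of the triple product\<close>

definition qfact :: "real \<Rightarrow> nat \<Rightarrow> real" where
  "qfact Q n = (\<Prod>i<n. 1 - Q * Q ^ i)"

text \<open>The value 0 at negative indices lets a finite sum be written over all integers, and the
  recursion \<open>inv_qfact_rec\<close> then has no boundary cases.\<close>

definition inv_qfact :: "real \<Rightarrow> int \<Rightarrow> real" where
  "inv_qfact Q j = (if j < 0 then 0 else inverse (qfact Q (nat j)))"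

lemma qfact_pos: "0 < Q \<Longrightarrow> Q < 1 \<Longrightarrow> qfact Q n > 0"
  unfolding qfact_def by (intro prod_pos) (auto simp: power_Suc_less_one simp flip: power_Suc)

lemma qfact_le_1: "0 < Q \<Longrightarrow> Q < 1 \<Longrightarrow> qfact Q n \<le> 1"
  unfolding qfact_def by (intro prod_le_1) (auto simp: power_le_one simp flip: power_Suc)

lemma qfact_LIMSEQ: "0 < Q \<Longrightarrow> Q < 1 \<Longrightarrow> qfact Q \<longlonglongrightarrow> qpoch Q Q"
  using qpoch_LIMSEQ[of Q Q] unfolding qfact_def by simp

lemma qfact_ge_qpoch:
  assumes "0 < Q" "Q < 1"
  shows "qpoch Q Q \<le> qfact Q n"
proof -
  have "decseq (qfact Q)"
  proof (rule decseq_SucI)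
    fix n
    have "qfact Q (Suc n) = qfact Q n * (1 - Q * Q ^ n)"
      by (simp add: qfact_def)
    also have "\<dots> \<le> qfact Q n"
      using qfact_pos[OF assms, of n] assms by (simp add: mult_le_cancel_left1)
    finally show "qfact Q (Suc n) \<le> qfact Q n" .
  qed
  then show ?thesis
    using decseq_ge[OF _ qfact_LIMSEQ[OF assms]] by blast
qed

lemma inv_qfact_bounds:
  assumes "0 < Q" "Q < 1"
  shows "0 \<le> inv_qfact Q j" "inv_qfact Q j \<le> inverse (qpoch Q Q)"
  using qfact_pos[OF assms] qfact_ge_qpoch[OF assms] qpoch_pos[OF assms assms(2)]
  by (auto simp: inv_qfact_def less_imp_le intro!: le_imp_inverse_le)

lemma inv_qfact_rec:
  assumes "0 < Q" "Q < 1"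
  shows "inv_qfact Q (j - 1) = (1 - Q powi j) * inv_qfact Q j"
proof (cases "j \<le> 0")
  \<comment> \<open>At \<open>j = 0\<close> the factor \<open>1 - Q powi j\<close> vanishes; for
    \<open>j < 0\<close> both reciprocals are 0 by convention.\<close>
  case True
  then show ?thesis
    by (cases "j = 0") (auto simp: inv_qfact_def)
next
  case False
  then obtain n where n: "j = int (Suc n)"
    using that[of "nat (j - 1)"] by simp
  have "1 - Q * Q ^ n \<noteq> 0"
    using assms power_Suc_less_one[of Q n] by simp
  moreover have "qfact Q (Suc n) = qfact Q n * (1 - Q * Q ^ n)"
    by (simp add: qfact_def)
  moreover have "Q powi j = Q * Q ^ n"
    unfolding n power_int_of_nat by simp
  moreover have "inv_qfact Q j = inverse (qfact Q (Suc n))" "inv_qfact Q (j - 1) = inverse (qfact Q n)"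
    unfolding n inv_qfact_def by (simp_all del: of_nat_Suc add: nat_diff_distrib)
  ultimately show ?thesis
    by simp
qed

text \<open>The coefficients are the Gaussian binomials of \<open>2 * n\<close> over
  \<open>n + k\<close>. In the induction step the two new factors multiply out to
  \<open>1 + Q ^ (2 * n + 1)\<close>, a term in \<open>z\<close> and a term in \<open>1 / z\<close>,
  which leave \<open>k\<close> fixed or shift it by one; coefficients are then compared.\<close>

lemma jacobi_triple_product_finite:
  assumes Q: "0 < Q" "Q < 1" and z: "z \<noteq> 0"
  shows "((\<lambda>k. theta_term Q (- z) k *
            (qfact Q (2 * n) * inv_qfact Q (int n + k) * inv_qfact Q (int n - k))) has_sum
          (\<Prod>i<n. (1 - z * Q ^ i) * (1 - Q / z * Q ^ i))) UNIV"
proof (induction n)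
  case 0
  have "((\<lambda>k. theta_term Q (- z) k * (inv_qfact Q k * inv_qfact Q (- k))) has_sum
      (\<Sum>k\<in>{0}. theta_term Q (- z) k * (inv_qfact Q k * inv_qfact Q (- k)))) {0}"
    by (rule has_sum_finite) simp
  then have "((\<lambda>k. theta_term Q (- z) k * (inv_qfact Q k * inv_qfact Q (- k))) has_sum 1) {0}"
    by (simp add: theta_term_def inv_qfact_def qfact_def)
  then have "((\<lambda>k. theta_term Q (- z) k * (inv_qfact Q k * inv_qfact Q (- k))) has_sum 1) UNIV"
    by (rule has_sum_cong_neutral[THEN iffD1, rotated -1]) (auto simp: inv_qfact_def)
  then show ?case
    by (simp add: qfact_def)
next
  case (Suc n)
  define T where "T = theta_term Q (- z)"
  define c where "c k = qfact Q (2 * n) * inv_qfact Q (int n + k) * inv_qfact Q (int n - k)" for k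
  define F where "F = (\<Prod>i<n. (1 - z * Q ^ i) * (1 - Q / z * Q ^ i))"
  have s0: "((\<lambda>k. T k * c k) has_sum F) UNIV"
    using Suc unfolding T_def c_def F_def .
  \<comment> \<open>The new terms in \<open>z\<close> and \<open>1 / z\<close> are absorbed by
    reindexing the same sum; this is harmless because it runs over all integers.\<close>
  have s1: "((\<lambda>k. T (k - 1) * c (k - 1)) has_sum F) UNIV"
    using s0 by (subst has_sum_reindex_bij_betw[where g = "\<lambda>k. k - 1" and B = UNIV and f = "\<lambda>k. T k * c k"])
      (auto intro: bij_betwI[of _ _ _ "\<lambda>k. k + 1"])
  have s2: "((\<lambda>k. T (k + 1) * c (k + 1)) has_sum F) UNIV"
    using s0 by (subst has_sum_reindex_bij_betw[where g = "\<lambda>k. k + 1" and B = UNIV and f = "\<lambda>k. T k * c k"])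
      (auto intro: bij_betwI[of _ _ _ "\<lambda>k. k - 1"])
  have "((\<lambda>k. (1 + Q ^ (2 * n + 1)) * (T k * c k) + (- z * Q ^ n) * (T (k - 1) * c (k - 1))
        + (- (Q ^ (n + 1)) / z) * (T (k + 1) * c (k + 1)))
      has_sum ((1 + Q ^ (2 * n + 1)) * F + (- z * Q ^ n) * F + (- (Q ^ (n + 1)) / z) * F)) UNIV"
    by (intro has_sum_add has_sum_cmult_right s0 s1 s2)
  moreover have "(1 + Q ^ (2 * n + 1)) * F + (- z * Q ^ n) * F + (- (Q ^ (n + 1)) / z) * F =
      F * ((1 - z * Q ^ n) * (1 - Q / z * Q ^ n))"
  proof -
    have "Q ^ (2 * n + 1) = Q * Q ^ n * Q ^ n" "Q ^ (n + 1) = Q * Q ^ n"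
      by (simp_all add: mult_2 power_add)
    then show ?thesis
      using z by (simp only:) (simp add: field_simps)
  qed
  moreover have "(1 + Q ^ (2 * n + 1)) * (T k * c k) + (- z * Q ^ n) * (T (k - 1) * c (k - 1))
        + (- (Q ^ (n + 1)) / z) * (T (k + 1) * c (k + 1)) =
      T k * (qfact Q (2 * Suc n) * inv_qfact Q (int (Suc n) + k) * inv_qfact Q (int (Suc n) - k))" for k
  proof -
    \<comment> \<open>All six reciprocals that occur are polynomial multiples of \<open>R\<close>
      and \<open>S\<close>, those of level \<open>n + 1\<close>, so the claim becomes a polynomial
      identity in \<open>a\<close>, \<open>b\<close> and \<open>Q\<close>.\<close>
    define a b R S where "a = Q powi (int n + k)" and "b = Q powi (int n - k)"
      and "R = inv_qfact Q (int n + 1 + k)" and "S = inv_qfact Q (int n + 1 - k)"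
    have aQ: "Q powi (int n + 1 + k) = a * Q" "Q powi (int n + 1 - k) = b * Q"
      using Q power_int_add_1[of Q "int n + k"] power_int_add_1[of Q "int n - k"]
      unfolding a_def b_def by (simp_all add: algebra_simps)
    have ab: "a * b = Q ^ (2 * n)"
    proof -
      have "a * b = Q powi (int (2 * n))"
        using Q unfolding a_def b_def by (subst power_int_add[symmetric]) auto
      then show ?thesis unfolding power_int_of_nat .
    qed
    have r1: "inv_qfact Q (int n + k) = (1 - a * Q) * R"
      using inv_qfact_rec[OF Q, of "int n + 1 + k"] unfolding aQ R_def by (simp add: add_ac)
    have r2: "inv_qfact Q (int n - k) = (1 - b * Q) * S"
      using inv_qfact_rec[OF Q, of "int n + 1 - k"] unfolding aQ S_def by simp
    have r3: "inv_qfact Q (int n + (k - 1)) = (1 - a) * ((1 - a * Q) * R)"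
      using inv_qfact_rec[OF Q, of "int n + k"] unfolding r1 a_def[symmetric] by (simp add: add_diff_eq)
    have r4: "inv_qfact Q (int n - (k + 1)) = (1 - b) * ((1 - b * Q) * S)"
      using inv_qfact_rec[OF Q, of "int n - k"] unfolding r2 b_def[symmetric] by (simp add: diff_diff_eq)
    have r5: "inv_qfact Q (int n - (k - 1)) = S" "inv_qfact Q (int n + (k + 1)) = R"
      "inv_qfact Q (int (Suc n) + k) = R" "inv_qfact Q (int (Suc n) - k) = S"
      unfolding R_def S_def by (simp_all add: algebra_simps)
    have q2: "qfact Q (2 * Suc n) = qfact Q (2 * n) * (1 - a * b * Q) * (1 - a * b * Q * Q)"
      using ab by (simp add: qfact_def mult_ac)
    have T1: "(- z * Q ^ n) * T (k - 1) = b * Q * T k"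
    proof -
      have "T k = - z * Q powi (k - 1) * T (k - 1)"
        using theta_term_add_1[of Q "- z" "k - 1"] Q z by (simp add: T_def)
      moreover have "b * Q * Q powi (k - 1) = Q ^ n"
        using Q unfolding aQ(2)[symmetric] by (subst power_int_add[symmetric]) (auto simp flip: power_int_of_nat)
      ultimately show ?thesis by simp
    qed
    have T2: "(- (Q ^ (n + 1)) / z) * T (k + 1) = a * Q * T k"
    proof -
      have "T (k + 1) = - z * Q powi k * T k"
        using theta_term_add_1[of Q "- z" k] Q z by (simp add: T_def)
      moreover have "a * Q = Q ^ (n + 1) * Q powi k"
        using Q by (simp add: a_def power_int_add)
      ultimately show ?thesis using z by auto
    qed
    have "(1 + Q ^ (2 * n + 1)) * (T k * c k) + (- z * Q ^ n) * (T (k - 1) * c (k - 1))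
        + (- (Q ^ (n + 1)) / z) * (T (k + 1) * c (k + 1)) =
        (1 + a * b * Q) * (T k * c k) + b * Q * T k * c (k - 1) + a * Q * T k * c (k + 1)"
      unfolding T1[symmetric] T2[symmetric] ab by (simp add: mult.assoc mult.commute)
    also have "\<dots> = T k * (qfact Q (2 * n) * R * S) *
      ((1 + a * b * Q) * ((1 - a * Q) * (1 - b * Q)) + b * Q * ((1 - a) * (1 - a * Q)) + a * Q * ((1 - b * Q) * (1 - b)))"
      unfolding c_def r1 r2 r3 r4 r5 by algebra
    \<comment> \<open>Since \<open>a * b = Q ^ (2 * n)\<close>, the right-hand side consists of the
      two factors that \<open>qfact\<close> gains from \<open>2 * n\<close> to
      \<open>2 * Suc n\<close>.\<close>
    also have "(1 + a * b * Q) * ((1 - a * Q) * (1 - b * Q)) + b * Q * ((1 - a) * (1 - a * Q)) + a * Q * ((1 - b * Q) * (1 - b))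
        = (1 - a * b * Q) * (1 - a * b * Q * Q)"
      by algebra
    finally show ?thesis unfolding q2 r5 by (simp add: mult_ac)
  qed
  ultimately show ?case
    unfolding F_def T_def by (simp add: mult.assoc)
qed

text \<open>Letting \<open>n\<close> tend to infinity in the finite form, each coefficient tends to
  \<open>inverse E\<close>, where \<open>E = qpoch Q Q\<close>.\<close>

theorem jacobi_triple_product:
  assumes Q: "0 < Q" "Q < 1" and z: "z \<noteq> 0"
  shows "(theta_term Q (- z) has_sum (qpoch Q Q * mod_theta Q z)) UNIV"
proof -
  define E where "E = qpoch Q Q"
  have E: "E > 0" using qpoch_pos[OF Q Q(2)] by (simp add: E_def)
  define a where "a k n = theta_term Q (- z) k *
    (qfact Q (2 * n) * inv_qfact Q (int n + k) * inv_qfact Q (int n - k))" for k n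
  have qf2: "(\<lambda>n. qfact Q (2 * n)) \<longlonglongrightarrow> E"
    using LIMSEQ_subseq_LIMSEQ[OF qfact_LIMSEQ[OF Q], of "\<lambda>n. 2 * n"]
    by (simp add: o_def strict_mono_def E_def)
  have iq: "(\<lambda>n. inv_qfact Q (int n + k)) \<longlonglongrightarrow> inverse E" for k
  proof -
    have "filterlim (\<lambda>n. nat (int n + k)) sequentially sequentially"
      unfolding filterlim_at_top eventually_sequentially
    proof (intro allI exI impI)
      fix Z n :: nat assume "n \<ge> Z + nat \<bar>k\<bar>"
      then show "Z \<le> nat (int n + k)" by linarith
    qed
    then have "(\<lambda>n. qfact Q (nat (int n + k))) \<longlonglongrightarrow> E"
      using filterlim_compose[OF qfact_LIMSEQ[OF Q]] by (simp add: E_def)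
    then have "(\<lambda>n. inverse (qfact Q (nat (int n + k)))) \<longlonglongrightarrow> inverse E"
      using E by (intro tendsto_inverse) auto
    \<comment> \<open>From \<open>n = - k\<close> on the index is nonnegative, so the default value
      0 of \<open>inv_qfact\<close> does not affect the limit.\<close>
    moreover have "eventually (\<lambda>n. inv_qfact Q (int n + k) = inverse (qfact Q (nat (int n + k)))) sequentially"
      using eventually_ge_at_top[of "nat (- k)"] by eventually_elim (auto simp: inv_qfact_def)
    ultimately show ?thesis
      by (simp add: tendsto_cong)
  qed
  have lim: "(\<lambda>n. a k n) \<longlonglongrightarrow> theta_term Q (- z) k * (E * inverse E * inverse E)" for k
    unfolding a_def using iq[of "- k"] by (intro tendsto_intros qf2 iq) simp
  \<comment> \<open>The bound is uniform in \<open>n\<close>, as \<open>qfact\<close> is at most 1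
    and each reciprocal at most \<open>inverse E\<close>; it is summable over
    \<open>k\<close>.\<close>
  have bd: "\<bar>a k n\<bar> \<le> \<bar>theta_term Q (- z) k\<bar> * (inverse E * inverse E)" for k n
  proof -
    have "\<bar>qfact Q (2 * n) * inv_qfact Q (int n + k) * inv_qfact Q (int n - k)\<bar> \<le> 1 * inverse E * inverse E"
      unfolding abs_mult E_def
      using inv_qfact_bounds[OF Q] qfact_le_1[OF Q] qfact_pos[OF Q] E
      by (intro mult_mono) (auto simp: E_def abs_of_nonneg less_imp_le)
    then show ?thesis
      unfolding a_def abs_mult[of "theta_term Q (- z) k"] by (intro mult_left_mono) auto
  qed
  have "(\<lambda>n. infsum (\<lambda>k. a k n) UNIV) \<longlonglongrightarrow> infsum (\<lambda>k. theta_term Q (- z) k * (E * inverse E * inverse E)) UNIV"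
    using summable_theta_term_nat[OF Q, of "- z"] summable_theta_term_neg[OF Q, of "- z"] z
    by (intro tannery_int[OF lim bd] summable_mult2) auto
  moreover have "infsum (\<lambda>k. a k n) UNIV = (\<Prod>i<n. (1 - z * Q ^ i) * (1 - Q / z * Q ^ i))" for n
    using jacobi_triple_product_finite[OF Q z, of n] unfolding a_def by (rule infsumI)
  moreover have "(\<lambda>n. \<Prod>i<n. (1 - z * Q ^ i) * (1 - Q / z * Q ^ i)) \<longlonglongrightarrow> mod_theta Q z"
    unfolding mod_theta_def prod.distrib using Q by (intro tendsto_mult qpoch_LIMSEQ) auto
  ultimately have "infsum (\<lambda>k. theta_term Q (- z) k * (E * inverse E * inverse E)) UNIV = mod_theta Q z"
    using LIMSEQ_unique by fastforce
  then have "infsum (theta_term Q (- z)) UNIV * inverse E = mod_theta Q z"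
    using E by (simp add: infsum_cmult_left')
  then have "infsum (theta_term Q (- z)) UNIV = E * mod_theta Q z"
    using E by (simp add: field_simps)
  moreover have "(theta_term Q (- z) has_sum infsum (theta_term Q (- z)) UNIV) UNIV"
    using theta_term_summable_on[OF Q, of "- z"] z by simp
  ultimately show ?thesis
    by (simp add: E_def)
qed

subsection \<open>The Weierstrass addition formula\<close>

text \<open>Unordered summability of reals is absolute, which justifies the iterated
  summation.\<close>

lemma has_sum_times:
  fixes f :: "'a \<Rightarrow> real" and g :: "'b \<Rightarrow> real"
  assumes f: "(f has_sum a) A" and g: "(g has_sum b) B"
  shows "((\<lambda>(x, y). f x * g y) has_sum (a * b)) (A \<times> B)"
proof (rule has_sum_SigmaI)
  show "((\<lambda>y. case (x, y) of (x, y) \<Rightarrow> f x * g y) has_sum (f x * b)) B" for x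
    using has_sum_cmult_right[OF g, of "f x"] by simp
  show "((\<lambda>x. f x * b) has_sum (a * b)) A"
    using has_sum_cmult_left[OF f] .
  have fa: "(\<lambda>x. norm (f x)) summable_on A" and ga: "(\<lambda>y. norm (g y)) summable_on B"
    using has_sum_imp_summable[OF f] has_sum_imp_summable[OF g]
    by (blast intro: summable_on_iff_abs_summable_on_real[THEN iffD1])+
  have "(\<lambda>z. norm (case z of (x, y) \<Rightarrow> f x * g y)) summable_on A \<times> B"
    unfolding Infinite_Sum.abs_summable_on_Sigma_iff
  proof (intro conjI ballI)
    show "(\<lambda>y. norm (case (x, y) of (x, y) \<Rightarrow> f x * g y)) summable_on B" for x
      using summable_on_cmult_right[OF ga, of "norm (f x)"] by (simp add: abs_mult)
    have "norm (infsum (\<lambda>y. norm (case (x, y) of (x, y) \<Rightarrow> f x * g y)) B) =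
        norm (f x) * infsum (\<lambda>y. norm (g y)) B" for x
      by (simp add: abs_mult infsum_cmult_right' infsum_nonneg)
    then show "(\<lambda>x. norm (infsum (\<lambda>y. norm (case (x, y) of (x, y) \<Rightarrow> f x * g y)) B)) summable_on A"
      using summable_on_cmult_left[OF fa, of "infsum (\<lambda>y. norm (g y)) B"] by simp
  qed
  then show "(\<lambda>(x, y). f x * g y) summable_on A \<times> B"
    by (rule abs_summable_summable)
qed

lemma twice_triangular: "2 * (n * (n - 1) div 2) = n * (n - 1 :: int)"
  by simp

text \<open>In the coordinates \<open>i + j\<close>, \<open>i - j\<close> the sum of the two
  triangular exponents separates into a part in \<open>i\<close> and a part in \<open>j\<close>. The
  signs cancel because the indices add up to an even number.\<close>

lemma theta_term_times_even:
  assumes "Q \<noteq> 0" "x \<noteq> 0" "y \<noteq> 0"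
  shows "theta_term Q (- (x * y)) (i + j) * theta_term Q (- (x / y)) (i - j) =
         theta_term (Q\<^sup>2) (x\<^sup>2) i * theta_term (Q\<^sup>2) (Q * y\<^sup>2) j"
proof -
  define t where "t n = n * (n - 1) div 2" for n :: int
  have t: "2 * t n = n * n - n" for n
    unfolding t_def twice_triangular by (simp add: algebra_simps)
  have "2 * (t (i + j) + t (i - j)) = 2 * (2 * t i + 2 * t j + j)"
    unfolding distrib_left t by (simp add: t algebra_simps)
  then have e: "t (i + j) + t (i - j) = 2 * t i + 2 * t j + j" by simp
  have "Q powi t (i + j) * Q powi t (i - j) = (Q\<^sup>2) powi t i * (Q\<^sup>2) powi t j * Q powi j"
  proof -
    have "Q powi t (i + j) * Q powi t (i - j) = Q powi (2 * t i + 2 * t j + j)"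
      unfolding e[symmetric] using assms by (simp add: power_int_add)
    also have "\<dots> = Q powi (2 * t i) * Q powi (2 * t j) * Q powi j"
      using assms by (simp add: power_int_add)
    finally show ?thesis
      unfolding power_int_mult by simp
  qed
  moreover have "(- (x * y)) powi (i + j) * (- (x / y)) powi (i - j) = (x\<^sup>2) powi i * (y\<^sup>2) powi j"
  proof -
    have neg: "- (x * y) = (- 1) * (x * y)" "- (x / y) = (- 1) * (x / y)" by simp_all
    have "(- 1 :: real) powi (i + j) * (- 1) powi (i - j) = 1"
      by (subst power_int_add[symmetric]) (auto simp: power_int_mult)
    moreover have "(x * y) powi (i + j) * (x / y) powi (i - j) = (x\<^sup>2) powi i * (y\<^sup>2) powi j"
      using assms by (simp add: power_int_mult_distrib power_int_divide_distrib power_int_add power_int_diff power2_eq_square)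
    moreover have "(- (x * y)) powi (i + j) * (- (x / y)) powi (i - j) =
        ((- 1) powi (i + j) * (- 1) powi (i - j)) * ((x * y) powi (i + j) * (x / y) powi (i - j))"
      unfolding neg power_int_mult_distrib by (simp only: mult_ac)
    ultimately show ?thesis
      by (simp only: mult_1)
  qed
  ultimately have "(Q powi t (i + j) * Q powi t (i - j)) * ((- (x * y)) powi (i + j) * (- (x / y)) powi (i - j)) =
      ((Q\<^sup>2) powi t i * (Q\<^sup>2) powi t j * Q powi j) * ((x\<^sup>2) powi i * (y\<^sup>2) powi j)"
    by (simp only:)
  then show ?thesis
    unfolding theta_term_def t_def[symmetric] power_int_mult_distrib by (simp only: mult_ac)
qed

text \<open>Raising the first index by one reduces this to the even case.\<close>

lemma theta_term_times_odd:
  assumes "Q \<noteq> 0" "x \<noteq> 0" "y \<noteq> 0"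
  shows "theta_term Q (- (x * y)) (i + j + 1) * theta_term Q (- (x / y)) (i - j) =
         (- x * theta_term (Q\<^sup>2) (Q * x\<^sup>2) i) * (y * theta_term (Q\<^sup>2) (Q\<^sup>2 * y\<^sup>2) j)"
proof -
  have "theta_term Q (- (x * y)) (i + j + 1) * theta_term Q (- (x / y)) (i - j) =
      - (x * y) * Q powi (i + j) * (theta_term (Q\<^sup>2) (x\<^sup>2) i * theta_term (Q\<^sup>2) (Q * y\<^sup>2) j)"
    using assms by (simp add: theta_term_add_1 flip: theta_term_times_even)
  then show ?thesis
    using assms by (simp add: theta_term_def power_int_add power_int_mult_distrib power2_eq_square)
qed

definition theta_series :: "real \<Rightarrow> real \<Rightarrow> real" where
  "theta_series Q z = infsum (theta_term Q z) UNIV"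

lemma theta_series_has_sum:
  assumes "0 < Q" "Q < 1" "z \<noteq> 0"
  shows "(theta_term Q z has_sum theta_series Q z) UNIV"
  using theta_term_summable_on[OF assms] by (simp add: theta_series_def)

lemma theta_series_shift:
  assumes "0 < Q" "Q < 1" "z \<noteq> 0"
  shows "theta_series Q z = z * theta_series Q (Q * z)"
proof -
  have "((\<lambda>k. theta_term Q z (k + 1)) has_sum theta_series Q z) UNIV"
    using theta_series_has_sum[OF assms]
    by (subst has_sum_reindex_bij_betw[where g = "\<lambda>k. k + 1" and B = UNIV and f = "theta_term Q z"])
      (auto intro: bij_betwI[of _ _ _ "\<lambda>k. k - 1"])
  moreover have "theta_term Q z (k + 1) = z * theta_term Q (Q * z) k" for k
    using assms theta_term_add_1[of Q z k] by (simp add: theta_term_def power_int_mult_distrib)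
  moreover have "((\<lambda>k. z * theta_term Q (Q * z) k) has_sum (z * theta_series Q (Q * z))) UNIV"
    using theta_series_has_sum[of Q "Q * z"] assms by (intro has_sum_cmult_right) auto
  ultimately show ?thesis
    by (simp only: has_sum_unique)
qed

text \<open>
  Splitting the double series over \<open>(m, n)\<close> by the parity of \<open>m + n\<close> shows that
  \<open>\<theta>(xy) \<theta>(x/y)\<close> is a \<open>2 \<times> 2\<close> determinant up to the factor \<open>x\<close>.
\<close>

lemma theta_series_times:
  assumes Q: "0 < Q" "Q < 1" and "x \<noteq> 0" "y \<noteq> 0"
  defines "u \<equiv> \<lambda>z. z * theta_series (Q\<^sup>2) (Q\<^sup>2 * z\<^sup>2)" and "v \<equiv> \<lambda>z. theta_series (Q\<^sup>2) (Q * z\<^sup>2)"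
  shows "theta_series Q (- (x * y)) * theta_series Q (- (x / y)) = x * (u x * v y - v x * u y)"
proof -
  define f where "f = (\<lambda>(m, n). theta_term Q (- (x * y)) m * theta_term Q (- (x / y)) n)"
  define g0 where "g0 = (\<lambda>(i :: int, j). (i + j, i - j))"
  define g1 where "g1 = (\<lambda>(i :: int, j). (i + j + 1, i - j))"
  have Q2: "0 < Q\<^sup>2" "Q\<^sup>2 < 1"
    using Q by (auto simp: power_less_one_iff)
  have F: "(f has_sum (theta_series Q (- (x * y)) * theta_series Q (- (x / y)))) UNIV"
    using has_sum_times[OF theta_series_has_sum[OF Q] theta_series_has_sum[OF Q], of "- (x * y)" "- (x / y)"] assms
    unfolding f_def by simp
  have "((\<lambda>(i, j). theta_term (Q\<^sup>2) (x\<^sup>2) i * theta_term (Q\<^sup>2) (Q * y\<^sup>2) j) has_sum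
      (theta_series (Q\<^sup>2) (x\<^sup>2) * theta_series (Q\<^sup>2) (Q * y\<^sup>2))) (UNIV \<times> UNIV)"
    using assms by (intro has_sum_times theta_series_has_sum Q2) auto
  also have "(\<lambda>(i, j). theta_term (Q\<^sup>2) (x\<^sup>2) i * theta_term (Q\<^sup>2) (Q * y\<^sup>2) j) = f \<circ> g0"
    using assms by (auto simp: f_def g0_def fun_eq_iff theta_term_times_even)
  \<comment> \<open>The shift by one index replaces the argument \<open>x\<^sup>2\<close> by
    \<open>Q\<^sup>2 * x\<^sup>2\<close>, so that both parities use the same functions
    \<open>u\<close> and \<open>v\<close>.\<close>
  also have "theta_series (Q\<^sup>2) (x\<^sup>2) * theta_series (Q\<^sup>2) (Q * y\<^sup>2) = x * (u x * v y)"
    using theta_series_shift[OF Q2, of "x\<^sup>2"] assms by (simp add: u_def v_def power2_eq_square)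
  finally have 0: "(f has_sum (x * (u x * v y))) (range g0)"
    by (subst has_sum_reindex) (auto simp: inj_on_def g0_def o_def)
  have "((\<lambda>(i, j). (- x * theta_term (Q\<^sup>2) (Q * x\<^sup>2) i) * (y * theta_term (Q\<^sup>2) (Q\<^sup>2 * y\<^sup>2) j)) has_sum
      ((- x * theta_series (Q\<^sup>2) (Q * x\<^sup>2)) * (y * theta_series (Q\<^sup>2) (Q\<^sup>2 * y\<^sup>2)))) (UNIV \<times> UNIV)"
    using assms by (intro has_sum_times has_sum_cmult_right theta_series_has_sum Q2) auto
  also have "(\<lambda>(i, j). (- x * theta_term (Q\<^sup>2) (Q * x\<^sup>2) i) * (y * theta_term (Q\<^sup>2) (Q\<^sup>2 * y\<^sup>2) j)) = f \<circ> g1"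
    using assms by (auto simp: f_def g1_def fun_eq_iff theta_term_times_odd)
  also have "(- x * theta_series (Q\<^sup>2) (Q * x\<^sup>2)) * (y * theta_series (Q\<^sup>2) (Q\<^sup>2 * y\<^sup>2)) = - (x * (v x * u y))"
    by (simp add: u_def v_def)
  finally have 1: "(f has_sum - (x * (v x * u y))) (range g1)"
    by (subst has_sum_reindex) (auto simp: inj_on_def g1_def o_def)
  have "(m, n) \<in> range g0 \<union> range g1" for m n
  proof (cases "even (m + n)")
    case True
    then obtain c where "m + n = 2 * c" by (rule evenE)
    then have "(m, n) = g0 (c, c - n)"
      unfolding g0_def by simp
    then show ?thesis by (metis UnI1 rangeI)
  next
    case False
    then obtain c where "m + n = 2 * c + 1" by (rule oddE)
    then have "(m, n) = g1 (c, c - n)"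
      unfolding g1_def by simp
    then show ?thesis by (metis UnI2 rangeI)
  qed
  then have "range g0 \<union> range g1 = UNIV" by auto
  moreover have "range g0 \<inter> range g1 = {}"
  proof -
    have "even (fst p + snd p)" if "p \<in> range g0" for p
      using that by (auto simp: g0_def)
    moreover have "odd (fst p + snd p)" if "p \<in> range g1" for p
      using that by (auto simp: g1_def)
    ultimately show ?thesis by blast
  qed
  ultimately have "(f has_sum (x * (u x * v y) + - (x * (v x * u y)))) UNIV"
    using has_sum_Un_disjoint[OF 0 1] by simp
  from has_sum_unique[OF F this] show ?thesis
    by (simp add: right_diff_distrib)
qed

text \<open>With the determinant \<open>[a,b] = u a * v b - v a * u b\<close>, each pair of theta
  values is \<open>a * [a,b]\<close> up to the factor \<open>E\<^sup>2\<close>. The powers of the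
  variables on both sides become \<open>x * y * z\<close>, and what remains is
  \<open>[x,y][z,w] = [x,z][y,w] - [x,w][y,z]\<close>.\<close>

theorem weierstrass_addition:
  assumes Q: "0 < Q" "Q < 1" and nz: "x \<noteq> 0" "y \<noteq> 0" "z \<noteq> 0" "w \<noteq> 0"
  defines "th \<equiv> mod_theta Q"
  shows "y * (th (x * y) * th (x / y) * th (z * w) * th (z / w)) =
    z * (th (x * z) * th (x / z) * th (y * w) * th (y / w) - th (x * w) * th (x / w) * th (y * z) * th (y / z))"
proof -
  define E where "E = qpoch Q Q"
  define u v where "u = (\<lambda>z. z * theta_series (Q\<^sup>2) (Q\<^sup>2 * z\<^sup>2))" and "v = (\<lambda>z. theta_series (Q\<^sup>2) (Q * z\<^sup>2))"
  have E: "E \<noteq> 0" using qpoch_pos[OF Q Q(2)] by (simp add: E_def)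
  have J: "theta_series Q (- a) = E * th a" if "a \<noteq> 0" for a
    using jacobi_triple_product[OF Q that] unfolding theta_series_def E_def th_def by (rule infsumI)
  have D: "E\<^sup>2 * (th (a * b) * th (a / b)) = a * (u a * v b - v a * u b)" if "a \<noteq> 0" "b \<noteq> 0" for a b
    using theta_series_times[OF Q that] that unfolding u_def v_def by (simp add: J power2_eq_square mult_ac)
  have "E\<^sup>2 * E\<^sup>2 * (y * (th (x * y) * th (x / y) * th (z * w) * th (z / w))) =
      y * (E\<^sup>2 * (th (x * y) * th (x / y))) * (E\<^sup>2 * (th (z * w) * th (z / w)))"
    by (simp add: mult_ac)
  also have "\<dots> = z * ((E\<^sup>2 * (th (x * z) * th (x / z))) * (E\<^sup>2 * (th (y * w) * th (y / w)))
      - (E\<^sup>2 * (th (x * w) * th (x / w))) * (E\<^sup>2 * (th (y * z) * th (y / z))))"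
    unfolding D[OF nz(1,2)] D[OF nz(3,4)] D[OF nz(1,3)] D[OF nz(2,4)] D[OF nz(1,4)] D[OF nz(2,3)]
    by algebra
  also have "\<dots> = E\<^sup>2 * E\<^sup>2 * (z * (th (x * z) * th (x / z) * th (y * w) * th (y / w)
      - th (x * w) * th (x / w) * th (y * z) * th (y / z)))"
    by algebra
  finally show ?thesis
    using E by simp
qed

subsection \<open>Generating functions of partitions\<close>

text \<open>Positive parts number at most \<open>n\<close> and are at most \<open>n\<close>, so
  finitely many lists represent all these multisets.\<close>

lemma finite_partitions:
  assumes "0 \<notin> S"
  shows "finite {P :: nat multiset. set_mset P \<subseteq> S \<and> sum_mset P = n}"
proof (rule finite_subset)
  have size: "size P \<le> sum_mset P" if "0 \<notin># P" for P :: "nat multiset"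
    using that by (induction P) (auto simp: Suc_le_eq)
  show "{P. set_mset P \<subseteq> S \<and> sum_mset P = n} \<subseteq> mset ` {xs. set xs \<subseteq> {..n} \<and> length xs \<le> n}"
  proof
    fix P assume "P \<in> {P. set_mset P \<subseteq> S \<and> sum_mset P = n}"
    then have P: "set_mset P \<subseteq> S" "sum_mset P = n" by auto
    obtain xs where xs: "mset xs = P" using ex_mset by blast
    have "length xs \<le> n"
      using size[of P] P assms xs by (auto simp flip: size_mset)
    moreover have "set xs \<subseteq> {..n}"
      using P xs by (auto simp flip: set_mset_mset dest!: multi_member_split)
    ultimately show "P \<in> mset ` {xs. set xs \<subseteq> {..n} \<and> length xs \<le> n}"
      using xs by blast
  qed
  show "finite (mset ` {xs. set xs \<subseteq> {..n} \<and> length xs \<le> n})"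
    by (intro finite_imageI finite_lists_length_le) simp
qed

lemma partition_count_mono: "0 \<notin> T \<Longrightarrow> S \<subseteq> T \<Longrightarrow> partition_count S n \<le> partition_count T n"
  unfolding partition_count_def by (intro card_mono finite_partitions) auto

text \<open>No part exceeds the sum; hence each single coefficient of an infinite set of parts is
  computed by a finite one.\<close>

lemma partition_count_cut:
  assumes "n \<le> N"
  shows "partition_count (S \<inter> {..N}) n = partition_count S n"
proof -
  have "x \<le> sum_mset P" if "x \<in># P" for x and P :: "nat multiset"
    using that by (auto dest!: multi_member_split)
  then have "{P. set_mset P \<subseteq> S \<inter> {..N} \<and> sum_mset P = n} = {P. set_mset P \<subseteq> S \<and> sum_mset P = n}"
    using assms by force
  then show ?thesis
    by (simp add: partition_count_def)
qed

lemma partition_count_empty: "partition_count {} n = (if n = 0 then 1 else 0)"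
  by (auto simp: partition_count_def cong: conj_cong)

text \<open>Partitions without \<open>s\<close> are counted by the first summand; from the others
  one copy of \<open>s\<close> is removed.\<close>

lemma partition_count_insert:
  assumes "0 \<notin> S" "s > 0" "s \<notin> S"
  shows "partition_count (insert s S) n =
    partition_count S n + (if s \<le> n then partition_count (insert s S) (n - s) else 0)"
proof -
  let ?A = "\<lambda>S n. {P :: nat multiset. set_mset P \<subseteq> S \<and> sum_mset P = n}"
  let ?B = "{P \<in> ?A (insert s S) n. s \<in># P}"
  have fin: "finite (?A (insert s S) n)" "finite (?A S n)"
    using assms by (auto intro: finite_partitions)
  have split: "?A (insert s S) n = ?A S n \<union> ?B" "?A S n \<inter> ?B = {}"
    using assms by auto
  have "card (?A (insert s S) n) = card (?A S n) + card ?B"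
    using fin split by (metis (no_types, lifting) card_Un_disjoint finite_Un)
  moreover have "card ?B = (if s \<le> n then card (?A (insert s S) (n - s)) else 0)"
  proof (cases "s \<le> n")
    case True
    have "?B = add_mset s ` ?A (insert s S) (n - s)"
    proof (intro equalityI subsetI)
      fix P assume "P \<in> ?B"
      then obtain P' where "P = add_mset s P'" "P \<in> ?A (insert s S) n"
        by (auto dest: multi_member_split)
      then show "P \<in> add_mset s ` ?A (insert s S) (n - s)" by auto
    qed (use True in auto)
    then show ?thesis
      using True by (simp add: card_image inj_on_def)
  next
    case False
    then have "?B = {}"
      by (auto dest!: multi_member_split)
    with False show ?thesis
      by (simp only: card.empty if_False)
  qed
  ultimately show ?thesis
    by (simp add: partition_count_def)
qed

lemma sums_power_shift:
  fixes q :: real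
  assumes "(\<lambda>n. a n * q ^ n) sums A"
  shows "(\<lambda>n. (if k \<le> n then a (n - k) else 0) * q ^ n) sums (q ^ k * A)"
proof -
  have "(\<lambda>n. (if k \<le> n + k then a (n + k - k) else 0) * q ^ (n + k)) sums (q ^ k * A)"
    using sums_mult[OF assms, of "q ^ k"] by (simp add: power_add mult_ac)
  then show ?thesis
    by (subst (asm) sums_iff_shift) simp
qed

text \<open>The recursion of \<open>partition_count_insert\<close> gives
  \<open>A = B + q ^ s * A\<close> for the sums with and without the part \<open>s\<close>, provided
  that the new series converges.\<close>

lemma partition_gf_finite:
  fixes q :: real
  assumes "finite S" "0 \<notin> S" and q: "0 \<le> q" "q < 1"
  shows "(\<lambda>n. real (partition_count S n) * q ^ n) sums inverse (\<Prod>s\<in>S. 1 - q ^ s)"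
  using assms(1,2)
proof (induction S rule: finite_induct)
  case empty
  have "(\<lambda>n. real (partition_count {} n) * q ^ n) = (\<lambda>n. if n = 0 then 1 else 0)"
    by (auto simp: partition_count_empty)
  then show ?case
    using sums_single[of 0 "\<lambda>_. 1 :: real"] by simp
next
  case (insert s S)
  define a where "a n = real (partition_count (insert s S) n)" for n
  define b where "b n = real (partition_count S n)" for n
  define B where "B = inverse (\<Prod>s\<in>S. 1 - q ^ s)"
  have b: "(\<lambda>n. b n * q ^ n) sums B"
    using insert unfolding b_def B_def by simp
  have s: "s > 0" using insert by (cases s) auto
  have rec: "a n = b n + (if s \<le> n then a (n - s) else 0)" for n
    using partition_count_insert[of S s n] insert s by (simp add: a_def b_def)
  have qs: "q ^ s < 1" using q s by (simp add: power_less_one_iff)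
  have a0: "a n * q ^ n \<ge> 0" for n using q by (simp add: a_def)
  \<comment> \<open>Convergence comes from the same recursion for partial sums: they satisfy
    \<open>?A \<le> B + q ^ s * ?A\<close>, hence are bounded.\<close>
  have bound: "(\<Sum>n<N. a n * q ^ n) \<le> B / (1 - q ^ s)" for N
  proof -
    let ?A = "\<Sum>n<N. a n * q ^ n"
    have "?A = (\<Sum>n<N. b n * q ^ n) + (\<Sum>n<N. (if s \<le> n then a (n - s) else 0) * q ^ n)"
      unfolding sum.distrib[symmetric] by (subst rec) (simp add: distrib_right)
    also have "(\<Sum>n<N. b n * q ^ n) \<le> B"
      using sum_le_suminf[OF sums_summable[OF b], of "{..<N}"] sums_unique[OF b] q by (simp add: b_def)
    also have "(\<Sum>n<N. (if s \<le> n then a (n - s) else 0) * q ^ n) = (\<Sum>n\<in>{s..<N}. a (n - s) * q ^ n)"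
      by (rule sum.mono_neutral_cong_right) auto
    also have "\<dots> = (\<Sum>n<N - s. a n * q ^ (n + s))"
      by (rule sum.reindex_bij_witness[of _ "\<lambda>n. n + s" "\<lambda>n. n - s"]) auto
    also have "\<dots> = q ^ s * (\<Sum>n<N - s. a n * q ^ n)"
      by (simp add: sum_distrib_left power_add mult_ac)
    also have "\<dots> \<le> q ^ s * ?A"
      using a0 q by (intro mult_left_mono sum_mono2) auto
    finally have "?A * (1 - q ^ s) \<le> B" by (simp add: algebra_simps)
    then show ?thesis using qs by (simp add: pos_le_divide_eq)
  qed
  have "summable (\<lambda>n. a n * q ^ n)"
    using bound a0 by (rule summableI_nonneg_bounded[rotated])
  then obtain A where A: "(\<lambda>n. a n * q ^ n) sums A"
    by (auto simp: summable_def)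
  have "(\<lambda>n. b n * q ^ n + (if s \<le> n then a (n - s) else 0) * q ^ n) sums (B + q ^ s * A)"
    by (intro sums_add b sums_power_shift A)
  then have "(\<lambda>n. a n * q ^ n) sums (B + q ^ s * A)"
    by (subst rec) (simp add: distrib_right)
  with A have "A = B + q ^ s * A"
    by (rule sums_unique2)
  then have "A = B / (1 - q ^ s)"
    using qs by (simp add: field_simps)
  then show ?case
    using A insert qs by (simp add: a_def B_def field_simps)
qed

text \<open>A squeeze: the first \<open>N\<close> coefficients are unaffected by cutting
  \<open>S\<close> at \<open>m N\<close>, and cutting only lowers the others, so \<open>G N\<close>
  lies between the partial sum and the full sum.\<close>

lemma partition_gf:
  fixes q :: real
  assumes "0 \<notin> S" and q: "0 \<le> q" "q < 1"
    and m: "\<And>N. N \<le> m N"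
    and lim: "(\<lambda>N. \<Prod>s\<in>S \<inter> {..m N}. 1 - q ^ s) \<longlonglongrightarrow> L" "L > 0"
  shows "(\<lambda>n. real (partition_count S n) * q ^ n) sums inverse L"
proof -
  define G where "G N = inverse (\<Prod>s\<in>S \<inter> {..m N}. 1 - q ^ s)" for N
  define a where "a n = real (partition_count S n) * q ^ n" for n
  have a0: "a n \<ge> 0" for n using q by (simp add: a_def)
  have G: "(\<lambda>n. real (partition_count (S \<inter> {..m N}) n) * q ^ n) sums G N" for N
    unfolding G_def using assms by (intro partition_gf_finite) auto
  have GL: "G \<longlonglongrightarrow> inverse L"
    unfolding G_def using lim by (intro tendsto_inverse) auto
  then obtain K where K: "\<And>N. G N \<le> K"
    using convergent_imp_Bseq[of G] unfolding Bseq_def convergent_def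
    by (metis abs_le_D1 real_norm_def)
  have le: "(\<Sum>n<N. a n) \<le> G N" for N
  proof -
    have "(\<Sum>n<N. a n) = (\<Sum>n<N. real (partition_count (S \<inter> {..m N}) n) * q ^ n)"
      using m[of N] by (intro sum.cong) (auto simp: a_def partition_count_cut)
    also have "\<dots> \<le> G N"
      using sum_le_suminf[OF sums_summable[OF G[of N]], of "{..<N}"] sums_unique[OF G[of N]] q by simp
    finally show ?thesis .
  qed
  have "summable a"
    using a0 le K by (intro summableI_nonneg_bounded[of a K]) (auto intro: order_trans)
  then have A: "a sums suminf a" by (rule summable_sums)
  have ge: "G N \<le> suminf a" for N
    using assms by (intro sums_le[OF _ G A]) (auto simp: a_def intro!: mult_right_mono partition_count_mono)
  have "G \<longlonglongrightarrow> suminf a"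
    using le ge A unfolding sums_def by (intro tendsto_sandwich[of "\<lambda>N. \<Sum>n<N. a n" G _ "\<lambda>_. suminf a"]) auto
  with GL have "inverse L = suminf a"
    by (rule LIMSEQ_unique)
  with A show ?thesis
    by (simp add: a_def[abs_def])
qed

section \<open>Parts in residue classes and products of theta functions\<close>

lemma prod_periodic_set:
  fixes f :: "nat \<Rightarrow> real"
  assumes "C \<subseteq> {0<..<M}"
  shows "(\<Prod>s\<in>{n. n mod M \<in> C} \<inter> {..M * N}. f s) = (\<Prod>c\<in>C. \<Prod>i<N. f (M * i + c))"
proof -
  have "(\<Prod>c\<in>C. \<Prod>i<N. f (M * i + c)) = (\<Prod>(c, i)\<in>C \<times> {..<N}. f (M * i + c))"
    by (rule prod.cartesian_product)
  also have "\<dots> = (\<Prod>s\<in>{n. n mod M \<in> C} \<inter> {..M * N}. f s)"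
  proof (rule prod.reindex_bij_witness[of _ "\<lambda>s. (s mod M, s div M)" "\<lambda>(c, i). M * i + c"])
    fix s assume s: "s \<in> {n. n mod M \<in> C} \<inter> {..M * N}"
    \<comment> \<open>The residue 0 is not in \<open>C\<close>, so the closed range up to
      \<open>M * N\<close> contains exactly \<open>N\<close> full periods.\<close>
    then have "s \<noteq> M * N" "M > 0" using assms by auto
    with s show "(s mod M, s div M) \<in> C \<times> {..<N}"
      by (auto simp: less_mult_imp_div_less mult.commute)
  next
    fix p assume "p \<in> C \<times> {..<N}"
    then obtain c i where p: "p = (c, i)" "c \<in> C" "i < N" "0 < c" "c < M"
      using assms by auto
    have "M * i + c \<le> M * N"
      using p mult_le_mono2[of "Suc i" N M] by simp
    with p show "(case p of (c, i) \<Rightarrow> M * i + c) \<in> {n. n mod M \<in> C} \<inter> {..M * N}"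
      by simp
    show "((case p of (c, i) \<Rightarrow> M * i + c) mod M, (case p of (c, i) \<Rightarrow> M * i + c) div M) = p"
      using p by simp
  qed auto
  finally show ?thesis ..
qed

text \<open>Both \<open>r\<close> and \<open>M - r\<close> lie strictly between 0 and
  \<open>M\<close>, so they are genuine remainders and exclude \<open>n = 0\<close>.\<close>

lemma pm_residues_eq:
  fixes R :: "nat set" and M :: nat
  assumes "\<And>r. r \<in> R \<Longrightarrow> 0 < r \<and> 2 * r < M"
  shows "pm_residues (int ` R) (int M) = {n. n mod M \<in> R \<union> (\<lambda>r. M - r) ` R}"
proof -
  have 1: "[int n = int r] (mod int M) \<longleftrightarrow> n mod M = r" if "r \<in> R" for n r
    unfolding cong_int_iff using assms[OF that] by (simp add: unique_euclidean_semiring_class.cong_def)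
  have 2: "[int n = - int r] (mod int M) \<longleftrightarrow> n mod M = M - r" if "r \<in> R" for n r
  proof -
    have "[- int r = int (M - r)] (mod int M)"
      using assms[OF that] by (simp add: cong_iff_dvd_diff of_nat_diff)
    then have "[int n = - int r] (mod int M) \<longleftrightarrow> [int n = int (M - r)] (mod int M)"
      by (meson cong_sym cong_trans)
    also have "\<dots> \<longleftrightarrow> n mod M = M - r"
      unfolding cong_int_iff using assms[OF that] by (simp add: unique_euclidean_semiring_class.cong_def)
    finally show ?thesis .
  qed
  show ?thesis
    unfolding pm_residues_def using assms 1 2 by (fastforce intro: gr0I)
qed

text \<open>The bound \<open>2 * r < M\<close> keeps the classes of \<open>r\<close> and
  \<open>M - r\<close> disjoint; they supply the two factors of \<open>mod_theta\<close>.\<close>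

theorem partition_gf_pm_residues:
  fixes R :: "nat set" and M :: nat and q :: real
  assumes "finite R" and R: "\<And>r. r \<in> R \<Longrightarrow> 0 < r \<and> 2 * r < M" and "M > 0" and q: "0 < q" "q < 1"
  shows "(\<lambda>n. real (partition_count (pm_residues (int ` R) (int M)) n) * q ^ n) sums
    inverse (\<Prod>r\<in>R. mod_theta (q ^ M) (q ^ r))"
proof -
  define C where "C = R \<union> (\<lambda>r. M - r) ` R"
  define Q where "Q = q ^ M"
  have Q: "0 < Q" "Q < 1" using q \<open>M > 0\<close> by (auto simp: Q_def power_less_one_iff)
  have C: "C \<subseteq> {0<..<M}" using R by (fastforce simp: C_def)
  have "(\<Prod>s\<in>{n. n mod M \<in> C} \<inter> {..M * N}. 1 - q ^ s) = (\<Prod>c\<in>C. \<Prod>i<N. 1 - q ^ c * Q ^ i)" for N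
    unfolding prod_periodic_set[OF C] Q_def by (simp add: power_add mult.commute flip: power_mult)
  then have "(\<lambda>N. \<Prod>s\<in>{n. n mod M \<in> C} \<inter> {..M * N}. 1 - q ^ s) \<longlonglongrightarrow> (\<Prod>c\<in>C. qpoch (q ^ c) Q)"
    using Q by (simp only:) (intro tendsto_prod qpoch_LIMSEQ, simp)
  moreover have "(\<Prod>c\<in>C. qpoch (q ^ c) Q) > 0"
    using C Q q by (intro prod_pos qpoch_pos) (auto simp: power_less_one_iff)
  ultimately have "(\<lambda>n. real (partition_count {n. n mod M \<in> C} n) * q ^ n) sums inverse (\<Prod>c\<in>C. qpoch (q ^ c) Q)"
    using C q \<open>M > 0\<close> by (intro partition_gf[of _ _ "\<lambda>N. M * N"]) auto
  also have "{n. n mod M \<in> C} = pm_residues (int ` R) (int M)"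
    unfolding C_def using R by (intro pm_residues_eq[symmetric]) auto
  also have "(\<Prod>c\<in>C. qpoch (q ^ c) Q) = (\<Prod>r\<in>R. qpoch (q ^ r) Q) * (\<Prod>c\<in>(\<lambda>r. M - r) ` R. qpoch (q ^ c) Q)"
  proof -
    have "R \<inter> (\<lambda>r. M - r) ` R = {}"
    proof (rule equals0I)
      fix x assume "x \<in> R \<inter> (\<lambda>r. M - r) ` R"
      then obtain r where "x \<in> R" "r \<in> R" "x = M - r" by auto
      then show False using R[of x] R[of r] by linarith
    qed
    then show ?thesis
      unfolding C_def using \<open>finite R\<close> by (intro prod.union_disjoint) auto
  qed
  also have "(\<Prod>c\<in>(\<lambda>r. M - r) ` R. qpoch (q ^ c) Q) = (\<Prod>r\<in>R. qpoch (Q / q ^ r) Q)"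
  proof (subst prod.reindex)
    show "inj_on (\<lambda>r. M - r) R"
    proof (rule inj_onI)
      fix x y assume "x \<in> R" "y \<in> R" "M - x = M - y"
      then show "x = y" using R[of x] R[of y] by linarith
    qed
    show "prod ((\<lambda>c. qpoch (q ^ c) Q) \<circ> (\<lambda>r. M - r)) R = (\<Prod>r\<in>R. qpoch (Q / q ^ r) Q)"
    proof (rule prod.cong)
      fix r assume "r \<in> R"
      then have "r \<le> M" using R[of r] by simp
      then show "((\<lambda>c. qpoch (q ^ c) Q) \<circ> (\<lambda>r. M - r)) r = qpoch (Q / q ^ r) Q"
        using q by (simp add: Q_def power_diff)
    qed simp
  qed
  finally show ?thesis
    by (simp add: mod_theta_def Q_def prod.distrib)
qed

text \<open>A power series with a nonzero coefficient has isolated zeros, while the difference of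
  the two series vanishes on the whole interval.\<close>

lemma powser_eq_on_unit_interval:
  fixes a b :: "nat \<Rightarrow> real"
  assumes a: "\<And>q. 0 < q \<Longrightarrow> q < 1 \<Longrightarrow> (\<lambda>n. a n * q ^ n) sums f q"
    and b: "\<And>q. 0 < q \<Longrightarrow> q < 1 \<Longrightarrow> (\<lambda>n. b n * q ^ n) sums f q"
  shows "a = b"
proof (rule ccontr)
  assume "a \<noteq> b"
  then obtain m where m: "a m \<noteq> b m" by blast
  \<comment> \<open>Shifting the coefficients by one makes the series vanish at 0, as the identity theorem below requires.\<close>
  define c where "c = (\<lambda>n. case n of 0 \<Rightarrow> 0 | Suc k \<Rightarrow> a k - b k)"
  have c: "(\<lambda>n. c n * q ^ n) sums 0" if "0 < q" "q < 1" for q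
  proof -
    have "(\<lambda>n. q * (a n * q ^ n - b n * q ^ n)) sums (q * (f q - f q))"
      by (intro sums_mult sums_diff a b that)
    then have "(\<lambda>n. c (Suc n) * q ^ Suc n) sums 0"
      by (simp add: c_def algebra_simps)
    then show ?thesis
      by (subst (asm) sums_Suc_iff) (simp add: c_def)
  qed
  have sm: "(\<lambda>n. c n * (x - 0) ^ n) sums (\<Sum>n. c n * x ^ n)" if x: "norm (x - 0) < 1" for x
  proof -
    obtain r where r: "\<bar>x\<bar> < r" "r < 1" using x dense[of "\<bar>x\<bar>" 1] by auto
    have "summable (\<lambda>n. c n * x ^ n)"
      using powser_inside[OF sums_summable[OF c[of r]], of x] r by simp
    then show ?thesis by (simp add: summable_sums)
  qed
  have "(\<Sum>n. c n * 0 ^ n) = 0"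
    using powser_sums_zero[of c] by (simp add: sums_iff c_def)
  from powser_0_nonzero[of 1 0 c "\<lambda>x. \<Sum>n. c n * x ^ n" "Suc m", OF _ sm this]
  obtain s where s: "0 < s" "\<And>z. z \<in> cball 0 s - {0} \<Longrightarrow> (\<Sum>n. c n * z ^ n) \<noteq> 0"
    using m by (auto simp: c_def)
  \<comment> \<open>This point lies both in the zero-free punctured ball and in the unit
    interval.\<close>
  have "(\<Sum>n. c n * (min s (1 / 2)) ^ n) = 0"
    using c[of "min s (1 / 2)"] s(1) by (simp add: sums_iff)
  moreover have "min s (1 / 2) \<in> cball 0 s - {0}"
    using s(1) by (auto simp: min_def)
  ultimately show False
    using s(2) by blast
qed

section \<open>Weierstrass relations at powers of \<open>q\<close>\<close>

lemma weierstrass_powers: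
  fixes q :: real
  assumes q: "0 < q" "q < 1" and "M > 0" "a > b" "b > c" "c > d"
  defines "t \<equiv> \<lambda>k. mod_theta (q ^ M) (q ^ k)"
  shows "q ^ (b - c) * (t (a + b) * t (a - b) * t (c + d) * t (c - d)) =
    t (a + c) * t (a - c) * t (b + d) * t (b - d) - t (a + d) * t (a - d) * t (b + c) * t (b - c)"
proof -
  have Q: "0 < q ^ M" "q ^ M < 1" using q \<open>M > 0\<close> by (auto simp: power_less_one_iff)
  \<comment> \<open>The ordering of the exponents makes every subtraction of naturals below a true
    one.\<close>
  have d: "q ^ m / q ^ n = q ^ (m - n)" if "n < m" for m n
    using q that by (simp add: power_diff)
  have "q ^ b = q ^ c * q ^ (b - c)"
    using assms by (simp flip: power_add)
  moreover have "q ^ b * (t (a + b) * t (a - b) * t (c + d) * t (c - d)) = q ^ c *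
      (t (a + c) * t (a - c) * t (b + d) * t (b - d) - t (a + d) * t (a - d) * t (b + c) * t (b - c))"
    using weierstrass_addition[OF Q, of "q ^ a" "q ^ b" "q ^ c" "q ^ d"] assms
    unfolding t_def by (simp add: d power_add)
  ultimately show ?thesis
    using q by (simp add: mult.assoc)
qed

text \<open>Negating \<open>x\<close> and \<open>z\<close> keeps the arguments \<open>x * z\<close>,
  \<open>x / z\<close>, \<open>y * w\<close>, \<open>y / w\<close> positive and makes the other
  eight negative. The prefactor \<open>z\<close> changes sign too, which swaps the two terms on the
  right.\<close>

lemma weierstrass_signed_powers:
  fixes q :: real
  assumes q: "0 < q" "q < 1" and "M > 0" "a > b" "b > c" "c > d"
  defines "t \<equiv> \<lambda>k. mod_theta (q ^ M) (q ^ k)" and "s \<equiv> \<lambda>k. mod_theta (q ^ M) (- (q ^ k))"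
  shows "q ^ (b - c) * (s (a + b) * s (a - b) * s (c + d) * s (c - d)) =
    s (a + d) * s (a - d) * s (b + c) * s (b - c) - t (a + c) * t (a - c) * t (b + d) * t (b - d)"
proof -
  have Q: "0 < q ^ M" "q ^ M < 1" using q \<open>M > 0\<close> by (auto simp: power_less_one_iff)
  have d: "q ^ m / q ^ n = q ^ (m - n)" if "n < m" for m n
    using q that by (simp add: power_diff)
  have "q ^ b = q ^ c * q ^ (b - c)"
    using assms by (simp flip: power_add)
  moreover have "q ^ b * (s (a + b) * s (a - b) * s (c + d) * s (c - d)) = q ^ c *
      (s (a + d) * s (a - d) * s (b + c) * s (b - c) - t (a + c) * t (a - c) * t (b + d) * t (b - d))"
    using weierstrass_addition[OF Q, of "- (q ^ a)" "q ^ b" "- (q ^ c)" "q ^ d"] assms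
    unfolding t_def s_def by (simp add: d power_add algebra_simps)
  ultimately show ?thesis
    using q by (simp add: mult.assoc)
qed

section \<open>Elimination between two relations\<close>

lemma clear_denominators:
  fixes P R U V X k :: real
  assumes "P \<noteq> 0" "R \<noteq> 0" "U \<noteq> 0" "V \<noteq> 0" "k * (P / (R * U)) = R / (P * V) - X"
  shows "R\<^sup>2 * U - k * P\<^sup>2 * V = X * (P * R * U * V)"
proof -
  have "X = R / (P * V) - k * (P / (R * U))" using assms(5) by simp
  then show ?thesis
    using assms(1-4) by (simp add: field_simps power2_eq_square)
qed

text \<open>In either combination the mixed terms with \<open>r * p\<close> cancel, and both leave
  the same difference of squares, which \<open>W\<close> evaluates. One pair of relations thus
  yields two identities.\<close>

lemma eliminate_common_terms:
  fixes X Y Z W p r \<alpha> \<beta> \<gamma> \<delta> k l :: real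
  assumes X: "X * Z = r * \<alpha> + k * p * \<beta>" and Y: "Y * Z = r * \<gamma> + l * p * \<delta>"
    and W: "r\<^sup>2 * (\<alpha> * \<gamma>) - k * l * p\<^sup>2 * (\<beta> * \<delta>) = Z * W" and "Z \<noteq> 0"
  shows "X * r * \<gamma> - k * (Y * p * \<beta>) = W" "Y * r * \<alpha> - l * (X * p * \<delta>) = W"
proof -
  have "Z * (X * r * \<gamma> - k * (Y * p * \<beta>)) = (X * Z) * r * \<gamma> - k * ((Y * Z) * p * \<beta>)"
    by algebra
  also have "\<dots> = Z * W"
    unfolding X Y W[symmetric] by algebra
  finally show "X * r * \<gamma> - k * (Y * p * \<beta>) = W"
    using \<open>Z \<noteq> 0\<close> by simp
  have "Z * (Y * r * \<alpha> - l * (X * p * \<delta>)) = (Y * Z) * r * \<alpha> - l * ((X * Z) * p * \<delta>)"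
    by algebra
  also have "\<dots> = Z * W"
    unfolding X Y W[symmetric] by algebra
  finally show "Y * r * \<alpha> - l * (X * p * \<delta>) = W"
    using \<open>Z \<noteq> 0\<close> by simp
qed

text \<open>\<open>K\<close> collects the factors shared by two products \<open>K * A\<close> and
  \<open>K * B\<close>; dividing the hypothesis by \<open>K * A * B\<close> turns it into a relation
  between generating functions.\<close>

lemma inverse_difference:
  fixes K A B c e :: real
  assumes "K \<noteq> 0" "A \<noteq> 0" "B \<noteq> 0" "A - c * B = e * (K * A * B)"
  shows "inverse (K * B) = e + c * inverse (K * A)"
proof -
  have "inverse (K * B) = A / (K * A * B)" and "c * inverse (K * A) = c * B / (K * A * B)"
    using assms(1-3) by (simp_all add: divide_simps)
  moreover have "A = e * (K * A * B) + c * B"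
    using assms(4) by simp
  ultimately show ?thesis
    using assms(1-3) by (metis add_divide_distrib mult_eq_0_iff nonzero_mult_div_cancel_right)
qed

subsection \<open>Theta functions of modulus 60\<close>

locale theta60 =
  fixes q :: real
  assumes q: "0 < q" "q < 1"
begin

definition t :: "nat \<Rightarrow> real" where "t k = mod_theta (q ^ 60) (q ^ k)"

lemma t_reflect: "k \<le> 60 \<Longrightarrow> t (60 - k) = t k"
  using q mod_theta_reflect[of "q ^ k" "q ^ 60"] by (simp add: t_def power_diff)

lemma t_nonzero: "0 < k \<Longrightarrow> k < 60 \<Longrightarrow> t k \<noteq> 0"
proof -
  assume k: "0 < k" "k < 60"
  have "q ^ 60 / q ^ k = q ^ (60 - k)" using q k by (simp add: power_diff)
  then have "qpoch (q ^ k) (q ^ 60) > 0" "qpoch (q ^ 60 / q ^ k) (q ^ 60) > 0"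
    using q k by (auto intro!: qpoch_pos simp: power_less_one_iff)
  then show ?thesis by (simp add: t_def mod_theta_def)
qed

lemma theta30_plus: "k \<le> 30 \<Longrightarrow> mod_theta (q ^ 30) (q ^ k) = t k * t (30 - k)"
  using mod_theta_bisect[of "q ^ 30" "q ^ k"] q
  by (simp add: t_def power_diff power_less_one_iff flip: power_mult)

text \<open>The product of the values at \<open>q ^ k\<close> and at its negative is a theta
  function of modulus 60 at \<open>q ^ (2 * k)\<close>.\<close>

lemma theta30_minus:
  assumes "0 < k" "k < 30"
  shows "mod_theta (q ^ 30) (- (q ^ k)) = t (2 * k) / (t k * t (30 - k))"
proof -
  have "mod_theta (q ^ 30) (q ^ k) * mod_theta (q ^ 30) (- (q ^ k)) = t (2 * k)"
    using mod_theta_mult_minus[of "q ^ 30" "q ^ k"] q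
    by (simp add: t_def power_less_one_iff mult.commute flip: power_mult)
  then show ?thesis
    using assms t_nonzero[of k] t_nonzero[of "30 - k"] by (simp add: theta30_plus field_simps)
qed

lemmas t_weierstrass = weierstrass_powers[OF q, of 60, folded t_def]
lemmas theta30_weierstrass = weierstrass_signed_powers[OF q, of 30]

lemma t_reflects:
  "t 46 = t 14" "t 45 = t 15" "t 37 = t 23" "t 39 = t 21" "t 31 = t 29" "t 44 = t 16" "t 40 = t 20" "t 38 = t 22"
  "t 34 = t 26"
  using t_reflect[of 14] t_reflect[of 15] t_reflect[of 23] t_reflect[of 21] t_reflect[of 29]
    t_reflect[of 16] t_reflect[of 20] t_reflect[of 22] t_reflect[of 26] by simp_all

text \<open>The instantiation lists \<open>b\<close> before \<open>a\<close>: here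
  \<open>a = 27\<close>, \<open>b = 19\<close>, \<open>c = 18\<close>, \<open>d = 1\<close>.
  Arguments above 30 are reflected.\<close>

lemma theta_relation_9: "t 9 * (t 15 * t 18 * t 20) = t 26 * t 28 * (t 1 * t 23) + q * (t 8 * t 14) * (t 17 * t 19)"
  using t_weierstrass[of 19 27 18 1] by (simp add: t_reflects algebra_simps)

lemma theta_relation_21: "t 21 * (t 15 * t 18 * t 20) = t 26 * t 28 * (t 7 * t 29) + q ^ 7 * (t 8 * t 14) * (t 11 * t 13)"
  using t_weierstrass[of 19 27 12 1] by (simp add: t_reflects algebra_simps)

lemma theta_relation_27: "t 27 * (t 6 * t 15 * t 20) = t 4 * t 22 * (t 17 * t 29) + q ^ 4 * (t 2 * t 16) * (t 11 * t 23)"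
  using t_weierstrass[of 21 23 17 6] by (simp add: t_reflects algebra_simps)

text \<open>Its residues are those of \<open>theta_relation_9\<close> times 7, with the two products
  on the right exchanged. The placement of \<open>q\<^sup>2\<close> and the factor 1 fit
  \<open>eliminate_common_terms\<close>.\<close>

lemma theta_relation_3: "t 3 * (t 6 * t 15 * t 20) = t 4 * t 22 * (q\<^sup>2 * (t 1 * t 13)) + 1 * (t 2 * t 16) * (t 7 * t 19)"
  using t_weierstrass[of 9 13 7 6] by (simp add: t_reflects algebra_simps)

lemma theta_relation_signed_1:
  "(t 26 * t 28)\<^sup>2 * (t 1 * t 23 * (t 7 * t 29)) - q * q ^ 7 * (t 8 * t 14)\<^sup>2 * (t 17 * t 19 * (t 11 * t 13)) =
   t 15 * t 18 * t 20 * (t 1 * t 7 * t 8 * t 9 * t 10 * t 11 * t 12 * t 13 * t 14 * t 15 * t 17 * t 19 * t 21 * t 23 *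
     t 26 * t 28 * t 29)"
proof -
  let ?s = "\<lambda>k. mod_theta (q ^ 30) (- (q ^ k))" and ?r = "\<lambda>k. mod_theta (q ^ 30) (q ^ k)"
  have "q ^ 8 * (?s 23 * ?s 1 * ?s 4 * ?s 2) = ?s 13 * ?s 11 * ?s 14 * ?s 8 - ?r 15 * ?r 9 * ?r 12 * ?r 10"
    using theta30_weierstrass[of 11 12 3 1] by simp
  \<comment> \<open>The factors \<open>t 2\<close> and \<open>t 4\<close> cancel between numerators
    and denominators, as \<open>t 16\<close> and \<open>t 22\<close> do in the next product.\<close>
  also have "?s 23 * ?s 1 * ?s 4 * ?s 2 = (t 8 * t 14) / (t 26 * t 28 * (t 1 * t 23 * (t 7 * t 29)))"
    using theta30_minus[of 23] theta30_minus[of 1] theta30_minus[of 4] theta30_minus[of 2]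
      t_nonzero[of 2] t_nonzero[of 4] by (simp add: t_reflects mult_ac)
  also have "?s 13 * ?s 11 * ?s 14 * ?s 8 = (t 26 * t 28) / (t 8 * t 14 * (t 17 * t 19 * (t 11 * t 13)))"
    using theta30_minus[of 13] theta30_minus[of 11] theta30_minus[of 14] theta30_minus[of 8]
      t_nonzero[of 22] t_nonzero[of 16] by (simp add: mult_ac)
  also have "?r 15 * ?r 9 * ?r 12 * ?r 10 = t 15 * t 15 * (t 9 * t 21) * (t 12 * t 18) * (t 10 * t 20)"
    using theta30_plus[of 15] theta30_plus[of 9] theta30_plus[of 12] theta30_plus[of 10] by simp
  finally have "(t 26 * t 28)\<^sup>2 * (t 1 * t 23 * (t 7 * t 29)) - q ^ 8 * (t 8 * t 14)\<^sup>2 * (t 17 * t 19 * (t 11 * t 13)) =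
     t 15 * t 15 * (t 9 * t 21) * (t 12 * t 18) * (t 10 * t 20) *
     (t 8 * t 14 * (t 26 * t 28) * (t 1 * t 23 * (t 7 * t 29)) * (t 17 * t 19 * (t 11 * t 13)))"
    by (rule clear_denominators[rotated -1]) (simp_all add: t_nonzero)
  then show ?thesis
    by algebra
qed

lemma theta_relation_signed_2:
  "(t 4 * t 22)\<^sup>2 * (t 17 * t 29 * (q\<^sup>2 * (t 1 * t 13))) - q ^ 4 * 1 * (t 2 * t 16)\<^sup>2 * (t 11 * t 23 * (t 7 * t 19)) =
   t 6 * t 15 * t 20 * (q\<^sup>2 * (t 1 * t 2 * t 3 * t 4 * t 7 * t 10 * t 11 * t 13 * t 15 * t 16 * t 17 * t 19 * t 22 *
     t 23 * t 24 * t 27 * t 29))"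
proof -
  let ?s = "\<lambda>k. mod_theta (q ^ 30) (- (q ^ k))" and ?r = "\<lambda>k. mod_theta (q ^ 30) (q ^ k)"
  have "q\<^sup>2 * (?s 17 * ?s 1 * ?s 8 * ?s 4) = ?s 11 * ?s 7 * ?s 14 * ?s 2 - ?r 15 * ?r 3 * ?r 10 * ?r 6"
    using theta30_weierstrass[of 8 9 6 2] by simp
  also have "?s 17 * ?s 1 * ?s 8 * ?s 4 = (t 2 * t 16) / (t 4 * t 22 * (t 17 * t 29 * (t 1 * t 13)))"
    using theta30_minus[of 17] theta30_minus[of 1] theta30_minus[of 8] theta30_minus[of 4]
      t_nonzero[of 8] t_nonzero[of 26] by (simp add: t_reflects mult_ac)
  also have "?s 11 * ?s 7 * ?s 14 * ?s 2 = (t 4 * t 22) / (t 2 * t 16 * (t 11 * t 23 * (t 7 * t 19)))"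
    using theta30_minus[of 11] theta30_minus[of 7] theta30_minus[of 14] theta30_minus[of 2]
      t_nonzero[of 14] t_nonzero[of 28] by (simp add: mult_ac)
  also have "?r 15 * ?r 3 * ?r 10 * ?r 6 = t 15 * t 15 * (t 3 * t 27) * (t 10 * t 20) * (t 6 * t 24)"
    using theta30_plus[of 15] theta30_plus[of 3] theta30_plus[of 10] theta30_plus[of 6] by simp
  finally have "(t 4 * t 22)\<^sup>2 * (t 17 * t 29 * (t 1 * t 13)) - q\<^sup>2 * (t 2 * t 16)\<^sup>2 * (t 11 * t 23 * (t 7 * t 19)) =
     t 15 * t 15 * (t 3 * t 27) * (t 10 * t 20) * (t 6 * t 24) *
     (t 2 * t 16 * (t 4 * t 22) * (t 17 * t 29 * (t 1 * t 13)) * (t 11 * t 23 * (t 7 * t 19)))"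
    by (rule clear_denominators[rotated -1]) (simp_all add: t_nonzero)
  \<comment> \<open>The claim is this equation multiplied by \<open>q\<^sup>2\<close>, the factor
    carried by \<open>theta_relation_3\<close>.\<close>
  then show ?thesis
    by algebra
qed

text \<open>The first equation serves (i), the second (iv).\<close>

lemma theta_difference_1:
  "t 9 * (t 26 * t 28) * (t 7 * t 29) - q * (t 21 * (t 8 * t 14) * (t 17 * t 19)) =
   t 1 * t 7 * t 8 * t 9 * t 10 * t 11 * t 12 * t 13 * t 14 * t 15 * t 17 * t 19 * t 21 * t 23 * t 26 * t 28 * t 29"
  "t 21 * (t 26 * t 28) * (t 1 * t 23) - q ^ 7 * (t 9 * (t 8 * t 14) * (t 11 * t 13)) =
   t 1 * t 7 * t 8 * t 9 * t 10 * t 11 * t 12 * t 13 * t 14 * t 15 * t 17 * t 19 * t 21 * t 23 * t 26 * t 28 * t 29"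
  using eliminate_common_terms[OF theta_relation_9 theta_relation_21 theta_relation_signed_1]
  by (simp_all add: t_nonzero)

lemma theta_difference_2:
  "t 27 * (t 4 * t 22) * (t 1 * t 13) - q\<^sup>2 * (t 3 * (t 2 * t 16) * (t 11 * t 23)) =
   t 1 * t 2 * t 3 * t 4 * t 7 * t 10 * t 11 * t 13 * t 15 * t 16 * t 17 * t 19 * t 22 * t 23 * t 24 * t 27 * t 29"
  "t 3 * (t 4 * t 22) * (t 17 * t 29) - t 27 * (t 2 * t 16) * (t 7 * t 19) =
   q\<^sup>2 * (t 1 * t 2 * t 3 * t 4 * t 7 * t 10 * t 11 * t 13 * t 15 * t 16 * t 17 * t 19 * t 22 * t 23 * t 24 * t 27 * t 29)"
proof -
  let ?W = "t 1 * t 2 * t 3 * t 4 * t 7 * t 10 * t 11 * t 13 * t 15 * t 16 * t 17 * t 19 * t 22 * t 23 * t 24 * t 27 * t 29"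
  have *: "t 27 * (t 4 * t 22) * (q\<^sup>2 * (t 1 * t 13)) - q ^ 4 * (t 3 * (t 2 * t 16) * (t 11 * t 23)) = q\<^sup>2 * ?W"
    "t 3 * (t 4 * t 22) * (t 17 * t 29) - 1 * (t 27 * (t 2 * t 16) * (t 7 * t 19)) = q\<^sup>2 * ?W"
    using eliminate_common_terms[OF theta_relation_27 theta_relation_3 theta_relation_signed_2]
    by (simp_all add: t_nonzero)
  \<comment> \<open>The factor \<open>q\<^sup>2\<close> brought in by
    \<open>theta_relation_3\<close> is cancelled here; in the second equation it stays and becomes
    the exceptional coefficient of (iii).\<close>
  have "q\<^sup>2 * (t 27 * (t 4 * t 22) * (t 1 * t 13) - q\<^sup>2 * (t 3 * (t 2 * t 16) * (t 11 * t 23))) = q\<^sup>2 * ?W"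
    unfolding *(1)[symmetric] by algebra
  then show "t 27 * (t 4 * t 22) * (t 1 * t 13) - q\<^sup>2 * (t 3 * (t 2 * t 16) * (t 11 * t 23)) = ?W"
    using q by simp
  show "t 3 * (t 4 * t 22) * (t 17 * t 29) - t 27 * (t 2 * t 16) * (t 7 * t 19) = q\<^sup>2 * ?W"
    using *(2) by simp
qed

lemma partition_gf_60:
  assumes "R \<subseteq> {0<..<30}"
  shows "(\<lambda>n. real (partition_count (pm_residues (int ` R) 60) n) * q ^ n) sums inverse (\<Prod>r\<in>R. t r)"
proof -
  have "finite R" using assms finite_subset by blast
  moreover have "0 < r \<and> 2 * r < 60" if "r \<in> R" for r
    using assms that by auto
  ultimately show ?thesis
    using partition_gf_pm_residues[of R 60 q] q unfolding t_def by simp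
qed

section \<open>The four identities between generating functions\<close>

lemma gf_identity_1:
  "inverse (\<Prod>r\<in>{1, 8, 10, 11, 12, 13, 14, 15, 17, 19, 21, 23}. t r) =
   q ^ 0 + q ^ 1 * inverse (\<Prod>r\<in>{1, 7, 9, 10, 11, 12, 13, 15, 23, 26, 28, 29}. t r)"
  \<comment> \<open>The two sets share seven residues; each has five of its own, and together these
    are the seventeen factors of the difference.\<close>
  using inverse_difference[of "t 1 * t 10 * t 11 * t 12 * t 13 * t 15 * t 23"
      "t 7 * t 9 * t 26 * t 28 * t 29" "t 8 * t 14 * t 17 * t 19 * t 21" "q" "1"] theta_difference_1(1)
  by (simp add: t_nonzero mult_ac)

lemma gf_identity_2:
  "inverse (\<Prod>r\<in>{2, 3, 7, 10, 11, 15, 16, 17, 19, 23, 24, 29}. t r) =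
   q ^ 0 + q ^ 2 * inverse (\<Prod>r\<in>{1, 4, 7, 10, 13, 15, 17, 19, 22, 24, 27, 29}. t r)"
  using inverse_difference[of "t 7 * t 10 * t 15 * t 17 * t 19 * t 24 * t 29"
      "t 1 * t 4 * t 13 * t 22 * t 27" "t 2 * t 3 * t 11 * t 16 * t 23" "q\<^sup>2" "1"] theta_difference_2(1)
  by (simp add: t_nonzero mult_ac)

text \<open>The set called \<open>T\<close> in (iii) stands on the left, since it has the one
  additional partition.\<close>

lemma gf_identity_3:
  "inverse (\<Prod>r\<in>{1, 2, 7, 10, 11, 13, 15, 16, 19, 23, 24, 27}. t r) =
   q ^ 2 + q ^ 0 * inverse (\<Prod>r\<in>{1, 3, 4, 10, 11, 13, 15, 17, 22, 23, 24, 29}. t r)"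
  using inverse_difference[of "t 1 * t 10 * t 11 * t 13 * t 15 * t 23 * t 24"
      "t 3 * t 4 * t 17 * t 22 * t 29" "t 2 * t 7 * t 16 * t 19 * t 27" "1" "q\<^sup>2"] theta_difference_2(2)
  by (simp add: t_nonzero mult_ac)

lemma gf_identity_4:
  "inverse (\<Prod>r\<in>{7, 8, 9, 10, 11, 12, 13, 14, 15, 17, 19, 29}. t r) =
   q ^ 0 + q ^ 7 * inverse (\<Prod>r\<in>{1, 7, 10, 12, 15, 17, 19, 21, 23, 26, 28, 29}. t r)"
  using inverse_difference[of "t 7 * t 10 * t 12 * t 15 * t 17 * t 19 * t 29"
      "t 1 * t 21 * t 23 * t 26 * t 28" "t 8 * t 9 * t 11 * t 13 * t 14" "q ^ 7" "1"] theta_difference_1(2)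
  by (simp add: t_nonzero mult_ac)

end

section \<open>Comparison of coefficients\<close>

lemma sums_power_single:
  fixes q :: real
  shows "(\<lambda>n. (if n = k then 1 else 0) * q ^ n) sums q ^ k"
proof -
  have "(\<lambda>n. (if n = k then 1 else 0) * q ^ n) = (\<lambda>n. if n = k then q ^ n else 0)"
    by auto
  then show ?thesis
    using sums_single[of k "\<lambda>n. q ^ n"] by simp
qed

lemma shifted_coefficients:
  fixes a b :: "nat \<Rightarrow> nat"
  assumes a: "\<And>q. 0 < q \<Longrightarrow> q < 1 \<Longrightarrow> (\<lambda>n. real (a n) * q ^ n) sums F q"
    and b: "\<And>q. 0 < q \<Longrightarrow> q < 1 \<Longrightarrow> (\<lambda>n. real (b n) * q ^ n) sums G q"
    and eq: "\<And>q. 0 < q \<Longrightarrow> q < 1 \<Longrightarrow> F q = q ^ j + q ^ k * G q"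
  shows "a n = (if n = j then 1 else 0) + (if k \<le> n then b (n - k) else 0)"
proof -
  have "(\<lambda>n. ((if n = j then 1 else 0) + (if k \<le> n then real (b (n - k)) else 0)) * q ^ n) sums F q"
    if "0 < q" "q < 1" for q
    using sums_add[OF sums_power_single[of j q] sums_power_shift[OF b[OF that], of k]] eq[OF that]
    by (simp add: distrib_right)
  from powser_eq_on_unit_interval[OF a this]
  have "real (a n) = (if n = j then 1 else 0) + (if k \<le> n then real (b (n - k)) else 0)"
    by (rule fun_cong)
  then have "real (a n) = real ((if n = j then 1 else 0) + (if k \<le> n then b (n - k) else 0))"
    by simp
  then show ?thesis
    by (simp only: of_nat_eq_iff)
qed

text \<open>The residues are naturals in the generating functions but integers in
  \<open>pm_residues\<close>; the image under \<open>int\<close> mediates.\<close>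

lemma partition_shift:
  fixes R R' :: "nat set"
  assumes S: "S = int ` R" "R \<subseteq> {0<..<30}" and T: "T = int ` R'" "R' \<subseteq> {0<..<30}"
    and eq: "\<And>q. theta60 q \<Longrightarrow>
      inverse (\<Prod>r\<in>R. theta60.t q r) = q ^ j + q ^ k * inverse (\<Prod>r\<in>R'. theta60.t q r)"
  shows "partition_count (pm_residues S 60) n =
    (if n = j then 1 else 0) + (if k \<le> n then partition_count (pm_residues T 60) (n - k) else 0)"
  unfolding S(1) T(1)
  using theta60.partition_gf_60[OF theta60.intro, OF _ _ S(2)]
    theta60.partition_gf_60[OF theta60.intro, OF _ _ T(2)] eq[OF theta60.intro]
  by (rule shifted_coefficients)

theorem theorem12p6:
  shows
    "(let S = pm_residues {1, 8, 10, 11, 12, 13, 14, 15, 17, 19, 21, 23} 60;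
          T = pm_residues {1, 7, 9, 10, 11, 12, 13, 15, 23, 26, 28, 29} 60
      in \<forall>n\<ge>1. partition_count S n = partition_count T (n - 1)) \<and>
     (let S = pm_residues {2, 3, 7, 10, 11, 15, 16, 17, 19, 23, 24, 29} 60;
          T = pm_residues {1, 4, 7, 10, 13, 15, 17, 19, 22, 24, 27, 29} 60
      in \<forall>n\<ge>2. partition_count S n = partition_count T (n - 2)) \<and>
     (let S = pm_residues {1, 3, 4, 10, 11, 13, 15, 17, 22, 23, 24, 29} 60;
          T = pm_residues {1, 2, 7, 10, 11, 13, 15, 16, 19, 23, 24, 27} 60
      in \<forall>n. n \<noteq> 2 \<longrightarrow> partition_count S n = partition_count T n) \<and>
     (let S = pm_residues {7, 8, 9, 10, 11, 12, 13, 14, 15, 17, 19, 29} 60;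
          T = pm_residues {1, 7, 10, 12, 15, 17, 19, 21, 23, 26, 28, 29} 60
      in \<forall>n\<ge>7. partition_count S n = partition_count T (n - 7))"
proof -
  \<comment> \<open>The isolated 1 sits at \<open>n = 0\<close>, outside the range claimed in (i);
    likewise in (ii) and (iv).\<close>
  have 1: "partition_count (pm_residues {1, 8, 10, 11, 12, 13, 14, 15, 17, 19, 21, 23} 60) n =
      (if n = 0 then 1 else 0) +
      (if 1 \<le> n then partition_count (pm_residues {1, 7, 9, 10, 11, 12, 13, 15, 23, 26, 28, 29} 60) (n - 1) else 0)" for n
    by (rule partition_shift[OF _ _ _ _ theta60.gf_identity_1]) auto
  have 2: "partition_count (pm_residues {2, 3, 7, 10, 11, 15, 16, 17, 19, 23, 24, 29} 60) n =
      (if n = 0 then 1 else 0) +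
      (if 2 \<le> n then partition_count (pm_residues {1, 4, 7, 10, 13, 15, 17, 19, 22, 24, 27, 29} 60) (n - 2) else 0)" for n
    by (rule partition_shift[OF _ _ _ _ theta60.gf_identity_2]) auto
  \<comment> \<open>Here the isolated 1 sits at \<open>n = 2\<close>, the excluded value: 2 is a
    part in the set on the left only.\<close>
  have 3: "partition_count (pm_residues {1, 2, 7, 10, 11, 13, 15, 16, 19, 23, 24, 27} 60) n =
      (if n = 2 then 1 else 0) +
      (if 0 \<le> n then partition_count (pm_residues {1, 3, 4, 10, 11, 13, 15, 17, 22, 23, 24, 29} 60) (n - 0) else 0)" for n
    by (rule partition_shift[OF _ _ _ _ theta60.gf_identity_3]) auto
  have 4: "partition_count (pm_residues {7, 8, 9, 10, 11, 12, 13, 14, 15, 17, 19, 29} 60) n =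
      (if n = 0 then 1 else 0) +
      (if 7 \<le> n then partition_count (pm_residues {1, 7, 10, 12, 15, 17, 19, 21, 23, 26, 28, 29} 60) (n - 7) else 0)" for n
    by (rule partition_shift[OF _ _ _ _ theta60.gf_identity_4]) auto
  show ?thesis
    unfolding Let_def using 1 2 3 4 by simp
qed

end
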